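(* Let $P$ be a program, $G$ a p-goal and $SQ$ a stack-queue scheduling rule. If every p-SLD derivation of $G$ in $P$ via $SQ$ is finite, then every p-RSLD derivation of $G$ in $P$ via $SQ$ is finite.
   Context: A p-atom is a pair $a[p]$ of an atom $a$ and a rational priority $p$. A p-goal is a finite set of p-atoms with pairwise distinct priorities, regarded as a list ordered by increasing priority. Substitutions act on atoms and leave priorities unchanged. A clause is $h\leftarrow B$ with $h$ an atom and $B$ a p-goal; a program is a finite set of clauses. For p-goals with no common priority, $F+G=F\cup G$; $F|G$ denotes $F+G$ when all priorities of $F$ are smaller than those of $G$. A shifting $\underline{\pi}$ is a strictly increasing bijection $\mathbb{Q}\to\mathbb{Q}$ acting on priorities. Priority derivation step: for a p-goal $a|F$ ($a$ of least priority), clause $c=(h\leftarrow B)$, renaming $\xi$ with $var(a|F)\cap var(c\xi)=\emptyset$, idempotent relevant mgu $\theta$ of $a$ and $h\xi$, shifting $\underline{\pi}$ with $F$, $B\xi\underline{\pi}$ sharing no priority: $a|F\xrightarrow{c\xi,\theta}(F+B\xi\underline{\pi})\theta$. A p-SLD derivation of $G_0$ in $P$ is a finite or infinite sequence of such steps with clauses in $P$ and each renamed clause $c_j\xi_j$ variable-disjoint from $G_0$ and all earlier renamed clauses; it is via $S$ if all its steps belong to $S$. Lowering: for $c=(h\leftarrow B)$, a step $a\lambda\underline{\sigma}|(K\lambda\underline{\sigma}+X)\xrightarrow{c}(X+K\lambda\underline{\sigma}+B\xi''\underline{\theta}'')\alpha''$ is a lowering by $X$ of $a|K\xrightarrow{c}(K+B\xi'\underline{\theta}')\alpha'$;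 a congruent lowering if some shifting $\underline{\rho}$ has $K\underline{\rho}=K\underline{\sigma}$ and $B\underline{\theta}'\underline{\rho}=B\underline{\theta}''$. Steps are congruent lowerings of each other if each is a congruent lowering of the other. A set $S$ of steps is complete if (i) whenever some step $G\xrightarrow{c}\cdot$ exists, some step $G\xrightarrow{c}\cdot$ lies in $S$, and (ii) $S$ contains every step that is a congruent lowering of each other with a step of $S$. Stack-queue scheduling rule: a complete set $SQ$ of steps such that for every clause $c=(h\leftarrow B)$ there are p-goals $M_s,M_q$ with $B=M_s|M_q$ such that every step $a|K\xrightarrow{c\xi,\mu}R$ in $SQ$ satisfies $R=(M_s\xi\underline{\gamma}|K|M_q\xi\underline{\gamma})\mu$ for some shifting $\underline{\gamma}$. Priority reduced goal: $G>>^{\tau}N$ up to variable set $X$ if (i) $G=F+\{a_1[p_1],\dots,a_h[p_h]\}+A_1+\dots+A_h$ with $b\tau=a_j$ for every $b[s]\in A_j$; (ii) $N=F+\{a_1[r_1],\dots,a_h[r_h]\}$ with $r_j=\min(\{p_j\}\cup\{\text{priorities of }A_j\})$; (iii) $x\tau=x$ for all $x\in X\cup var(N)$. p-RSLD derivation of $G_0$ in $P$: a finite or infinite sequence $G_0>>^{\alpha_0}N_0\xrightarrow{c_0\xi_0,\theta_0}G_1>>^{\alpha_1}N_1\xrightarrow{c_1\xi_1,\theta_1}\cdots$ where each $N_j\xrightarrow{c_j\xi_j,\theta_j}G_{j+1}$ is a priority derivation step with $c_j\in P$ and $var(c_j\xi_j)\cap(var(G_0)\cup var(c_0\xi_0)\cup\dots\cup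 var(c_{j-1}\xi_{j-1}))=\emptyset$, and $G_j>>^{\alpha_j}N_j$ up to $var(G_0\theta_0\cdots\theta_{j-1})$; it is via $S$ if all its derivation steps belong to $S$. *)

theory Defs
  imports Complex_Main
begin

datatype ('f,'v) trm = Var 'v | Fn 'f "('f,'v) trm list"

type_synonym ('f,'v) subst = "'v \<Rightarrow> ('f,'v) trm"

fun tsubst :: "('f,'v) subst \<Rightarrow> ('f,'v) trm \<Rightarrow> ('f,'v) trm" where
  "tsubst \<sigma> (Var x) = \<sigma> x"
| "tsubst \<sigma> (Fn f ts) = Fn f (map (tsubst \<sigma>) ts)"

fun tvars :: "('f,'v) trm \<Rightarrow> 'v set" where
  "tvars (Var x) = {x}"
| "tvars (Fn f ts) = \<Union> (set (map tvars ts))"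

datatype ('p,'f,'v) atom = Atm 'p "('f,'v) trm list"

fun asubst :: "('f,'v) subst \<Rightarrow> ('p,'f,'v) atom \<Rightarrow> ('p,'f,'v) atom" where
  "asubst \<sigma> (Atm P ts) = Atm P (map (tsubst \<sigma>) ts)"

fun avars :: "('p,'f,'v) atom \<Rightarrow> 'v set" where
  "avars (Atm P ts) = \<Union> (tvars ` set ts)"

definition renaming :: "('f,'v) subst \<Rightarrow> bool" where
  "renaming \<xi> \<longleftrightarrow> (\<exists>f. bij f \<and> \<xi> = (\<lambda>x. Var (f x)))"

definition unifier :: "('f,'v) subst \<Rightarrow> ('p,'f,'v) atom \<Rightarrow> ('p,'f,'v) atom \<Rightarrow> bool" where
  "unifier \<theta> a b \<longleftrightarrow> asubst \<theta> a = asubst \<theta> b"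

definition is_mgu :: "('f,'v) subst \<Rightarrow> ('p,'f,'v) atom \<Rightarrow> ('p,'f,'v) atom \<Rightarrow> bool" where
  "is_mgu \<theta> a b \<longleftrightarrow> unifier \<theta> a b \<and>
     (\<forall>\<tau>. unifier \<tau> a b \<longrightarrow> (\<exists>\<delta>. \<forall>x. \<tau> x = tsubst \<delta> (\<theta> x)))"

definition idempotent :: "('f,'v) subst \<Rightarrow> bool" where
  "idempotent \<theta> \<longleftrightarrow> (\<forall>x. tsubst \<theta> (\<theta> x) = \<theta> x)"

definition sdom :: "('f,'v) subst \<Rightarrow> 'v set" where
  "sdom \<theta> = {x. \<theta> x \<noteq> Var x}"

definition srvars :: "('f,'v) subst \<Rightarrow> 'v set" where
  "srvars \<theta> = \<Union> ((\<lambda>x. tvars (\<theta> x)) ` sdom \<theta>)"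

definition relevant :: "('f,'v) subst \<Rightarrow> ('p,'f,'v) atom \<Rightarrow> ('p,'f,'v) atom \<Rightarrow> bool" where
  "relevant \<theta> a b \<longleftrightarrow> sdom \<theta> \<union> srvars \<theta> \<subseteq> avars a \<union> avars b"

type_synonym ('p,'f,'v) pgoal = "(('p,'f,'v) atom \<times> rat) set"

definition pgoal :: "('p,'f,'v) pgoal \<Rightarrow> bool" where
  "pgoal G \<longleftrightarrow> finite G \<and> inj_on snd G"

definition prios :: "('p,'f,'v) pgoal \<Rightarrow> rat set" where
  "prios G = snd ` G"

definition gvars :: "('p,'f,'v) pgoal \<Rightarrow> 'v set" where
  "gvars G = \<Union> ((\<lambda>ap. avars (fst ap)) ` G)"

definition gsubst :: "('f,'v) subst \<Rightarrow> ('p,'f,'v) pgoal \<Rightarrow> ('p,'f,'v) pgoal" where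
  "gsubst \<sigma> G = (\<lambda>(a,p). (asubst \<sigma> a, p)) ` G"

definition gshift :: "(rat \<Rightarrow> rat) \<Rightarrow> ('p,'f,'v) pgoal \<Rightarrow> ('p,'f,'v) pgoal" where
  "gshift \<pi> G = (\<lambda>(a,p). (a, \<pi> p)) ` G"

text \<open>F + G is defined: no common priority.\<close>
definition nocommon :: "('p,'f,'v) pgoal \<Rightarrow> ('p,'f,'v) pgoal \<Rightarrow> bool" where
  "nocommon F G \<longleftrightarrow> prios F \<inter> prios G = {}"

text \<open>F | G is defined: all priorities of F are smaller than those of G.\<close>
definition before :: "('p,'f,'v) pgoal \<Rightarrow> ('p,'f,'v) pgoal \<Rightarrow> bool" where
  "before F G \<longleftrightarrow> (\<forall>p\<in>prios F. \<forall>q\<in>prios G. p < q)"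

definition shifting :: "(rat \<Rightarrow> rat) \<Rightarrow> bool" where
  "shifting \<pi> \<longleftrightarrow> strict_mono \<pi> \<and> bij \<pi>"

definition selects :: "('p,'f,'v) pgoal \<Rightarrow> ('p,'f,'v) atom \<Rightarrow> rat \<Rightarrow> ('p,'f,'v) pgoal \<Rightarrow> bool" where
  "selects G a p K \<longleftrightarrow> (a,p) \<in> G \<and> K = G - {(a,p)} \<and> before {(a,p)} K"

type_synonym ('p,'f,'v) clause = "('p,'f,'v) atom \<times> ('p,'f,'v) pgoal"

definition is_clause :: "('p,'f,'v) clause \<Rightarrow> bool" where
  "is_clause c \<longleftrightarrow> pgoal (snd c)"

definition program :: "('p,'f,'v) clause set \<Rightarrow> bool" where
  "program P \<longleftrightarrow> finite P \<and> (\<forall>c\<in>P. is_clause c)"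

definition cvars :: "('p,'f,'v) clause \<Rightarrow> 'v set" where
  "cvars c = avars (fst c) \<union> gvars (snd c)"

definition csubst :: "('f,'v) subst \<Rightarrow> ('p,'f,'v) clause \<Rightarrow> ('p,'f,'v) clause" where
  "csubst \<xi> c = (asubst \<xi> (fst c), gsubst \<xi> (snd c))"

datatype ('p,'f,'v) pstep =
  Step (st_src: "('p,'f,'v) pgoal") (st_cl: "('p,'f,'v) clause") (st_ren: "('f,'v) subst")
       (st_mgu: "('f,'v) subst") (st_shift: "rat \<Rightarrow> rat") (st_res: "('p,'f,'v) pgoal")

definition is_step :: "('p,'f,'v) pstep \<Rightarrow> bool" where
  "is_step s \<longleftrightarrow> (case s of Step G c \<xi> \<theta> \<pi> R \<Rightarrow>
     is_clause c \<and> pgoal G \<and>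
     (\<exists>a p F. selects G a p F \<and> renaming \<xi> \<and> gvars G \<inter> cvars (csubst \<xi> c) = {} \<and>
        idempotent \<theta> \<and> relevant \<theta> a (asubst \<xi> (fst c)) \<and> is_mgu \<theta> a (asubst \<xi> (fst c)) \<and>
        shifting \<pi> \<and> nocommon F (gshift \<pi> (gsubst \<xi> (snd c))) \<and>
        R = gsubst \<theta> (F \<union> gshift \<pi> (gsubst \<xi> (snd c)))))"

definition lowering_wit ::
  "('p,'f,'v) pstep \<Rightarrow> ('p,'f,'v) pstep \<Rightarrow> ('p,'f,'v) pgoal \<Rightarrow> ('f,'v) subst \<Rightarrow> (rat \<Rightarrow> rat)
   \<Rightarrow> ('p,'f,'v) pgoal \<Rightarrow> ('p,'f,'v) atom \<Rightarrow> rat \<Rightarrow> bool" where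
  "lowering_wit s2 s1 X lam \<sigma> K a p \<longleftrightarrow>
     is_step s1 \<and> is_step s2 \<and> st_cl s2 = st_cl s1 \<and> shifting \<sigma> \<and>
     selects (st_src s1) a p K \<and>
     st_res s1 = gsubst (st_mgu s1) (K \<union> gshift (st_shift s1) (gsubst (st_ren s1) (snd (st_cl s1)))) \<and>
     nocommon (gshift \<sigma> (gsubst lam K)) X \<and>
     selects (st_src s2) (asubst lam a) (\<sigma> p) (gshift \<sigma> (gsubst lam K) \<union> X) \<and>
     st_res s2 = gsubst (st_mgu s2)
        (X \<union> gshift \<sigma> (gsubst lam K) \<union> gshift (st_shift s2) (gsubst (st_ren s2) (snd (st_cl s1))))"

definition congruent_lowering :: "('p,'f,'v) pstep \<Rightarrow> ('p,'f,'v) pstep \<Rightarrow> bool" where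
  "congruent_lowering s2 s1 \<longleftrightarrow>
     (\<exists>X lam \<sigma> K a p. lowering_wit s2 s1 X lam \<sigma> K a p \<and>
        (\<exists>\<rho>. shifting \<rho> \<and> gshift \<rho> K = gshift \<sigma> K \<and>
             gshift \<rho> (gshift (st_shift s1) (snd (st_cl s1))) = gshift (st_shift s2) (snd (st_cl s1))))"

definition congruent_each_other :: "('p,'f,'v) pstep \<Rightarrow> ('p,'f,'v) pstep \<Rightarrow> bool" where
  "congruent_each_other s s' \<longleftrightarrow> congruent_lowering s s' \<and> congruent_lowering s' s"

definition complete_steps :: "('p,'f,'v) pstep set \<Rightarrow> bool" where
  "complete_steps S \<longleftrightarrow>
     (\<forall>s\<in>S. is_step s) \<and>
     (\<forall>G c. (\<exists>s. is_step s \<and> st_src s = G \<and> st_cl s = c) \<longrightarrow>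
            (\<exists>s\<in>S. st_src s = G \<and> st_cl s = c)) \<and>
     (\<forall>s\<in>S. \<forall>s'. congruent_each_other s' s \<longrightarrow> s' \<in> S)"

definition stack_queue :: "('p,'f,'v) pstep set \<Rightarrow> bool" where
  "stack_queue SQ \<longleftrightarrow> complete_steps SQ \<and>
     (\<forall>c. \<exists>Ms Mq. snd c = Ms \<union> Mq \<and> before Ms Mq \<and>
        (\<forall>s\<in>SQ. st_cl s = c \<longrightarrow>
           (\<exists>a p K \<gamma>. selects (st_src s) a p K \<and> shifting \<gamma> \<and>
              before (gshift \<gamma> (gsubst (st_ren s) Ms)) K \<and>
              before K (gshift \<gamma> (gsubst (st_ren s) Mq)) \<and>
              before (gshift \<gamma> (gsubst (st_ren s) Ms)) (gshift \<gamma> (gsubst (st_ren s) Mq)) \<and>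
              st_res s = gsubst (st_mgu s)
                 (gshift \<gamma> (gsubst (st_ren s) Ms) \<union> K \<union> gshift \<gamma> (gsubst (st_ren s) Mq)))))"

definition renamed_vars :: "('p,'f,'v) pstep \<Rightarrow> 'v set" where
  "renamed_vars s = cvars (csubst (st_ren s) (st_cl s))"

definition inf_sld ::
  "('p,'f,'v) clause set \<Rightarrow> ('p,'f,'v) pstep set \<Rightarrow> ('p,'f,'v) pgoal \<Rightarrow> (nat \<Rightarrow> ('p,'f,'v) pstep) \<Rightarrow> bool" where
  "inf_sld P S G0 d \<longleftrightarrow> st_src (d 0) = G0 \<and>
     (\<forall>j. is_step (d j) \<and> st_cl (d j) \<in> P \<and> d j \<in> S \<and>
          st_res (d j) = st_src (d (Suc j)) \<and>
          renamed_vars (d j) \<inter> (gvars G0 \<union> (\<Union>i<j. renamed_vars (d i))) = {})"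

definition reduced ::
  "('p,'f,'v) pgoal \<Rightarrow> ('f,'v) subst \<Rightarrow> ('p,'f,'v) pgoal \<Rightarrow> 'v set \<Rightarrow> bool" where
  "reduced G \<tau> N X \<longleftrightarrow>
     (\<exists>F (h::nat) a p A.
        (\<forall>j<h. nocommon F ({(a j, p j)} \<union> A j) \<and> nocommon {(a j, p j)} (A j)) \<and>
        (\<forall>j<h. \<forall>k<h. j \<noteq> k \<longrightarrow> nocommon ({(a j, p j)} \<union> A j) ({(a k, p k)} \<union> A k)) \<and>
        G = F \<union> (\<Union>j<h. {(a j, p j)} \<union> A j) \<and>
        (\<forall>j<h. \<forall>b s. (b, s) \<in> A j \<longrightarrow> asubst \<tau> b = a j) \<and>
        N = F \<union> (\<lambda>j. (a j, Min ({p j} \<union> prios (A j)))) ` {..<h} \<and>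
        (\<forall>x \<in> X \<union> gvars N. \<tau> x = Var x))"

fun iter_subst :: "(nat \<Rightarrow> ('f,'v) subst) \<Rightarrow> nat \<Rightarrow> ('p,'f,'v) pgoal \<Rightarrow> ('p,'f,'v) pgoal" where
  "iter_subst \<theta> 0 G = G"
| "iter_subst \<theta> (Suc j) G = gsubst (\<theta> j) (iter_subst \<theta> j G)"

definition inf_rsld ::
  "('p,'f,'v) clause set \<Rightarrow> ('p,'f,'v) pstep set \<Rightarrow> ('p,'f,'v) pgoal \<Rightarrow>
   (nat \<Rightarrow> ('p,'f,'v) pgoal) \<Rightarrow> (nat \<Rightarrow> ('f,'v) subst) \<Rightarrow> (nat \<Rightarrow> ('p,'f,'v) pgoal) \<Rightarrow>
   (nat \<Rightarrow> ('p,'f,'v) pstep) \<Rightarrow> bool" where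
  "inf_rsld P S G0 Gs \<alpha> Ns d \<longleftrightarrow> Gs 0 = G0 \<and>
     (\<forall>j. reduced (Gs j) (\<alpha> j) (Ns j) (gvars (iter_subst (\<lambda>i. st_mgu (d i)) j G0)) \<and>
          is_step (d j) \<and> st_src (d j) = Ns j \<and> st_res (d j) = Gs (Suc j) \<and>
          st_cl (d j) \<in> P \<and> d j \<in> S \<and>
          renamed_vars (d j) \<inter> (gvars G0 \<union> (\<Union>i<j. renamed_vars (d i))) = {})"

end

(* An infinite reduced derivation is simulated by an unreduced one. Every atom of the simulating goal
   tracks, under a common instance, either an atom of the current reduced goal or an atom that the
   reduced derivation resolved at some earlier step t. If the first atom tracks an unresolved atom, the
   latter is the selected one and the reduced derivation advances; otherwise step t is copied.
   The simulation never waits for an atom which the reduced derivation neglects: a duplicate of an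
   atom resolved at step t comes after everything that the stack part of step t has
   produced, so all of this has been resolved when the duplicate is selected, and what the queue part adds
   is already tracked further ahead. Each simulating step lifts to one with a most general unifier and
   fresh variables. *)

theory Submission
  imports Defs
begin

section \<open>Substitutions and unification\<close>

text \<open>The simulation need not keep pace with the reduced derivation: copying old steps forever
  is harmless, because only an infinite unreduced derivation is wanted. It suffices that the
  simulating goal never becomes empty, and this comes from the reduced side, where every goal has a
  selected atom and every atom is tracked. The obstacle is that the rule hands over some step with a
  prescribed source and clause, under a shifting that cannot be chosen. What is known of it is that
  it is increasing and that the body is split around the rest of the goal in a way fixed by the
  clause. The invariant therefore compares only the order of trackers and never matches priorities
  of the two derivations.\<close>

definition subst_comp :: "('f,'v) subst \<Rightarrow> ('f,'v) subst \<Rightarrow> ('f,'v) subst" where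
  "subst_comp \<sigma> \<tau> = (\<lambda>x. tsubst \<tau> (\<sigma> x))"

lemma tsubst_subst_comp: "tsubst \<tau> (tsubst \<sigma> t) = tsubst (subst_comp \<sigma> \<tau>) t"
  by (induction t) (auto simp: subst_comp_def)

lemma asubst_subst_comp: "asubst \<tau> (asubst \<sigma> a) = asubst (subst_comp \<sigma> \<tau>) a"
  by (cases a) (simp add: tsubst_subst_comp)

lemma tsubst_cong: "(\<And>x. x \<in> tvars t \<Longrightarrow> \<sigma> x = \<tau> x) \<Longrightarrow> tsubst \<sigma> t = tsubst \<tau> t"
  by (induction t) auto

lemma asubst_cong: "(\<And>x. x \<in> avars a \<Longrightarrow> \<sigma> x = \<tau> x) \<Longrightarrow> asubst \<sigma> a = asubst \<tau> a"
  by (cases a) (auto intro!: tsubst_cong)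

lemma tsubst_Var [simp]: "tsubst Var t = t"
  by (induction t) (auto simp: map_idI)

lemma asubst_Var [simp]: "asubst Var a = a"
  by (cases a) (auto simp: map_idI)

lemma tvars_tsubst: "tvars (tsubst \<sigma> t) = (\<Union>x\<in>tvars t. tvars (\<sigma> x))"
  by (induction t) auto

lemma avars_asubst: "avars (asubst \<sigma> a) = (\<Union>x\<in>avars a. tvars (\<sigma> x))"
  by (cases a) (auto simp: tvars_tsubst)

lemma finite_tvars: "finite (tvars t)"
  by (induction t) auto

lemma finite_avars: "finite (avars a)"
  by (cases a) (auto simp: finite_tvars)

lemma finite_gvars: "finite G \<Longrightarrow> finite (gvars G)"
  by (auto simp: gvars_def finite_avars)

lemma size_tsubst_le: "x \<in> tvars t \<Longrightarrow> size (\<sigma> x) \<le> size (tsubst \<sigma> t)"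
proof (induction t)
  case (Fn f ts)
  then obtain u where u: "u \<in> set ts" "x \<in> tvars u" by auto
  have "size (\<sigma> x) \<le> size (tsubst \<sigma> u)" using Fn.IH u by blast
  also have "\<dots> \<le> size_list size (map (tsubst \<sigma>) ts)"
    using size_list_estimation'[of "tsubst \<sigma> u" "map (tsubst \<sigma>) ts" "size (tsubst \<sigma> u)" size] u by auto
  finally show ?case by simp
qed auto

text \<open>If \<open>x\<close> occurred strictly inside \<open>t\<close>, the instance of
  \<open>t\<close> would be strictly larger than the instance of \<open>x\<close>.\<close>

lemma occurs_check:
  assumes "x \<in> tvars t" "\<tau> x = tsubst \<tau> t"
  shows "t = Var x"
proof (cases t)
  case (Fn f ts)
  then obtain u where u: "u \<in> set ts" "x \<in> tvars u" using assms by auto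
  have "size (\<tau> x) \<le> size (tsubst \<tau> u)" by (rule size_tsubst_le[OF u(2)])
  also have "\<dots> \<le> size_list size (map (tsubst \<tau>) ts)"
    using size_list_estimation'[of "tsubst \<tau> u" "map (tsubst \<tau>) ts" "size (tsubst \<tau> u)" size] u by auto
  also have "\<dots> < size (tsubst \<tau> t)" using Fn by simp
  finally show ?thesis using assms by simp
qed (use assms in auto)

section \<open>Most general unifiers of equation lists\<close>

definition unifies :: "('f,'v) subst \<Rightarrow> (('f,'v) trm \<times> ('f,'v) trm) list \<Rightarrow> bool" where
  "unifies \<tau> E \<longleftrightarrow> (\<forall>(s,t)\<in>set E. tsubst \<tau> s = tsubst \<tau> t)"

definition evars :: "(('f,'v) trm \<times> ('f,'v) trm) list \<Rightarrow> 'v set" where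
  "evars E = (\<Union>(s,t)\<in>set E. tvars s \<union> tvars t)"

text \<open>Generality is put as absorption, with the unifier itself as the mediating substitution.
  Absorption applied to \<theta> gives idempotence, and it later lets one and the same instance
  describe a goal before and after a unifier is applied.\<close>

definition strong_mgu :: "('f,'v) subst \<Rightarrow> (('f,'v) trm \<times> ('f,'v) trm) list \<Rightarrow> bool" where
  "strong_mgu \<theta> E \<longleftrightarrow> unifies \<theta> E \<and> (\<forall>\<tau>. unifies \<tau> E \<longrightarrow> subst_comp \<theta> \<tau> = \<tau>) \<and>
     sdom \<theta> \<union> srvars \<theta> \<subseteq> evars E"

lemma unifies_simps:
  "unifies \<tau> []"
  "unifies \<tau> ((s,t) # E) \<longleftrightarrow> tsubst \<tau> s = tsubst \<tau> t \<and> unifies \<tau> E"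
  "unifies \<tau> (E @ E') \<longleftrightarrow> unifies \<tau> E \<and> unifies \<tau> E'"
  by (auto simp: unifies_def)

lemma evars_simps:
  "evars [] = {}"
  "evars ((s,t) # E) = tvars s \<union> tvars t \<union> evars E"
  "evars (E @ E') = evars E \<union> evars E'"
  by (auto simp: evars_def)

lemma finite_evars: "finite (evars E)"
  unfolding evars_def by (intro finite_UN_I) (auto simp: finite_tvars)

lemma unifies_zip:
  "length ts = length us \<Longrightarrow> unifies \<tau> (zip ts us) \<longleftrightarrow> map (tsubst \<tau>) ts = map (tsubst \<tau>) us"
  by (induction ts us rule: list_induct2) (auto simp: unifies_simps)

lemma evars_zip:
  "length ts = length us \<Longrightarrow> evars (zip ts us) = \<Union> (tvars ` set ts) \<union> \<Union> (tvars ` set us)"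
  by (induction ts us rule: list_induct2) (auto simp: evars_simps)

definition elim :: "'v \<Rightarrow> ('f,'v) trm \<Rightarrow> ('f,'v) subst" where
  "elim x t = Var(x := t)"

definition esubst :: "('f,'v) subst \<Rightarrow> (('f,'v) trm \<times> ('f,'v) trm) list \<Rightarrow> (('f,'v) trm \<times> ('f,'v) trm) list" where
  "esubst \<sigma> E = map (\<lambda>(s,t). (tsubst \<sigma> s, tsubst \<sigma> t)) E"

lemma unifies_esubst: "unifies \<tau> (esubst \<sigma> E) \<longleftrightarrow> unifies (subst_comp \<sigma> \<tau>) E"
  by (auto simp: unifies_def esubst_def tsubst_subst_comp)

lemma subst_comp_elim: "\<tau> x = tsubst \<tau> t \<Longrightarrow> subst_comp (elim x t) \<tau> = \<tau>"
  by (auto simp: subst_comp_def elim_def)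

lemma tvars_elim: "x \<notin> tvars t \<Longrightarrow> tvars (tsubst (elim x t) s) \<subseteq> (tvars s \<union> tvars t) - {x}"
  by (auto simp: tvars_tsubst elim_def split: if_splits)

lemma evars_elim: "x \<notin> tvars t \<Longrightarrow> evars (esubst (elim x t) E) \<subseteq> (evars E \<union> tvars t) - {x}"
  using tvars_elim[of x t] by (fastforce simp: evars_def esubst_def)

lemma sdom_srvars_iff:
  "sdom \<theta> \<union> srvars \<theta> \<subseteq> V \<longleftrightarrow> (\<forall>x. \<theta> x \<noteq> Var x \<longrightarrow> x \<in> V \<and> tvars (\<theta> x) \<subseteq> V)"
  by (auto simp: sdom_def srvars_def)

text \<open>A unifier of the whole list absorbs \<open>elim x t\<close>, so it also unifies the
  substituted rest and absorbs \<theta>; the two absorptions compose.\<close>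

lemma strong_mgu_elim:
  assumes x: "x \<notin> tvars t" and \<theta>: "strong_mgu \<theta> (esubst (elim x t) E)"
  shows "strong_mgu (subst_comp (elim x t) \<theta>) ((Var x, t) # E)"
proof -
  let ?\<rho> = "elim x t"
  have elim_t: "tsubst ?\<rho> t = t"
    using x by (intro trans[OF tsubst_cong[of t ?\<rho> Var] tsubst_Var]) (auto simp: elim_def)
  have "unifies (subst_comp ?\<rho> \<theta>) ((Var x, t) # E)"
    using \<theta> elim_t tsubst_subst_comp[of \<theta> ?\<rho> t]
    by (auto simp: strong_mgu_def unifies_simps unifies_esubst) (simp add: subst_comp_def elim_def)
  moreover have "subst_comp (subst_comp ?\<rho> \<theta>) \<tau> = \<tau>" if "unifies \<tau> ((Var x, t) # E)" for \<tau>
  proof -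
    have "subst_comp ?\<rho> \<tau> = \<tau>" using that by (intro subst_comp_elim) (auto simp: unifies_simps)
    moreover from this have "subst_comp \<theta> \<tau> = \<tau>"
      using that \<theta> by (simp add: strong_mgu_def unifies_esubst unifies_simps)
    moreover have "subst_comp (subst_comp ?\<rho> \<theta>) \<tau> = subst_comp ?\<rho> (subst_comp \<theta> \<tau>)"
      by (auto simp: subst_comp_def tsubst_subst_comp)
    ultimately show ?thesis by simp
  qed
  moreover have "y \<in> evars ((Var x, t) # E) \<and> tvars (subst_comp ?\<rho> \<theta> y) \<subseteq> evars ((Var x, t) # E)"
    if y: "subst_comp ?\<rho> \<theta> y \<noteq> Var y" for y
  proof -
    have ev: "evars (esubst ?\<rho> E) \<subseteq> evars ((Var x, t) # E)"
      using evars_elim[OF x] by (auto simp: evars_simps)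
    have t: "tvars (\<theta> z) \<subseteq> evars ((Var x, t) # E)" if "z \<in> evars ((Var x, t) # E)" for z
      using \<theta> ev that unfolding strong_mgu_def sdom_srvars_iff
      by (cases "\<theta> z = Var z") auto
    show ?thesis
    proof (cases "y = x")
      case True
      then have "subst_comp ?\<rho> \<theta> y = tsubst \<theta> t" by (simp add: subst_comp_def elim_def)
      then show ?thesis using t True by (auto simp: tvars_tsubst evars_simps)
    next
      case False
      then have eq: "subst_comp ?\<rho> \<theta> y = \<theta> y" by (simp add: subst_comp_def elim_def)
      then have "y \<in> evars (esubst ?\<rho> E)"
        using y \<theta> unfolding strong_mgu_def sdom_srvars_iff by auto
      then show ?thesis using ev t eq by auto
    qed
  qed
  ultimately show ?thesis unfolding strong_mgu_def sdom_srvars_iff by blast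
qed

lemma strong_mgu_swap: "strong_mgu \<theta> ((s,t) # E) \<Longrightarrow> strong_mgu \<theta> ((t,s) # E)"
  by (auto simp: strong_mgu_def unifies_simps evars_simps)

text \<open>Unification by transformation of the list. The given \<tau> unifies every intermediate
  list, so neither a clash nor a failing occurs check can arise. Eliminating a variable lowers the
  first component of the measure. Decomposition keeps the variables and strips a function symbol on
  the left, so counting left sides is enough; the length makes deleting a trivial equation
  decrease.\<close>

lemma strong_mgu_exists: "unifies \<tau> E \<Longrightarrow> \<exists>\<theta>. strong_mgu \<theta> E"
proof (induction E rule: wf_induct_rule
    [OF wf_measures[of "[\<lambda>E. card (evars E), \<lambda>E. sum_list (map (size \<circ> fst) E) + length E]"]])
  case (1 E)
  note IH = "1.IH" and \<tau> = "1.prems"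
  \<comment> \<open>Only the variables and sizes of \<open>E\<close> enter here, not its first
    equation, so the claim serves a variable on either side.\<close>
  have var: "\<exists>\<theta>. strong_mgu \<theta> ((Var x, t) # E')"
    if E: "evars ((Var x, t) # E') = evars E" and len: "length E = Suc (length E')"
      and sz: "sum_list (map (size \<circ> fst) E') \<le> sum_list (map (size \<circ> fst) E)"
      and u: "unifies \<tau> ((Var x, t) # E')" for x t E'
  proof (cases "t = Var x")
    case True
    have "card (evars E') \<le> card (evars E)"
      unfolding E[symmetric] by (intro card_mono) (auto simp: finite_evars finite_tvars evars_simps)
    then have "(E', E) \<in> measures [\<lambda>E. card (evars E), \<lambda>E. sum_list (map (size \<circ> fst) E) + length E]"
      using sz len by (auto simp: le_less)
    then obtain \<theta> where "strong_mgu \<theta> E'"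
      using IH[of E'] u by (auto simp: unifies_simps)
    then have "strong_mgu \<theta> ((Var x, t) # E')"
      using True by (auto simp: strong_mgu_def unifies_simps evars_simps)
    then show ?thesis by blast
  next
    case False
    have eq: "\<tau> x = tsubst \<tau> t" using u by (simp add: unifies_simps)
    then have x: "x \<notin> tvars t" using occurs_check[OF _ eq] False by auto
    have "evars (esubst (elim x t) E') \<subset> evars E"
      using evars_elim[OF x, of E'] unfolding E[symmetric] by (auto simp: evars_simps)
    then have "card (evars (esubst (elim x t) E')) < card (evars E)"
      by (intro psubset_card_mono finite_evars)
    moreover have "unifies \<tau> (esubst (elim x t) E')"
      using u subst_comp_elim[of \<tau> x t, OF eq] by (simp add: unifies_esubst unifies_simps)
    ultimately obtain \<theta> where "strong_mgu \<theta> (esubst (elim x t) E')"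
      using IH[of "esubst (elim x t) E'"] by auto
    from strong_mgu_elim[OF x this] show ?thesis
      by (rule exI[where x = "subst_comp (elim x t) \<theta>"])
  qed
  show ?case
  proof (cases E)
    case Nil
    have "strong_mgu Var E"
      unfolding Nil by (auto simp: strong_mgu_def unifies_simps subst_comp_def sdom_def srvars_def)
    then show ?thesis by blast
  next
    case (Cons e E')
    obtain s t where e: "e = (s,t)" by (cases e)
    note E = Cons[unfolded e]
    show ?thesis
    proof (cases s)
      case (Var x)
      then show ?thesis using var[of x t E'] \<tau> E by auto
    next
      case s: (Fn f ts)
      show ?thesis
      proof (cases t)
        case (Var x)
        have "\<exists>\<theta>. strong_mgu \<theta> ((Var x, s) # E')"
          using var[of x s E'] \<tau> E Var by (auto simp: unifies_simps evars_simps)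
        then show ?thesis using strong_mgu_swap E Var by blast
      next
        case t: (Fn g us)
        have fg: "f = g" and maps: "map (tsubst \<tau>) ts = map (tsubst \<tau>) us"
          using \<tau> by (auto simp: E s t unifies_simps)
        then have len: "length ts = length us" by (metis length_map)
        let ?E = "zip ts us @ E'"
        have ev: "evars ?E = evars E"
          by (auto simp: E s t evars_simps evars_zip[OF len])
        have un: "unifies \<sigma> ?E \<longleftrightarrow> unifies \<sigma> E" for \<sigma>
          by (auto simp: E s t unifies_simps unifies_zip[OF len] fg)
        have "sum_list (map (size \<circ> fst) (zip ts us)) + length (zip ts us) = size_list size ts"
          using len by (induction ts us rule: list_induct2) auto
        then have "sum_list (map (size \<circ> fst) ?E) + length ?E < sum_list (map (size \<circ> fst) E) + length E"
          by (simp add: E s)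
        then obtain \<theta> where "strong_mgu \<theta> ?E" using IH[of ?E] un \<tau> ev by auto
        then have "strong_mgu \<theta> E" by (simp add: strong_mgu_def un ev)
        then show ?thesis by blast
      qed
    qed
  qed
qed

lemma relevant_mgu_exists:
  fixes a b :: "('p,'f,'v) atom"
  assumes "asubst \<tau> a = asubst \<tau> b"
  obtains \<theta> where "idempotent \<theta>" "relevant \<theta> a b" "is_mgu \<theta> a b"
    "\<And>\<sigma>. asubst \<sigma> a = asubst \<sigma> b \<Longrightarrow> subst_comp \<theta> \<sigma> = \<sigma>"
proof -
  obtain P ts where a: "a = Atm P ts" by (cases a)
  obtain Q us where b: "b = Atm Q us" by (cases b)
  have PQ: "P = Q" and maps: "map (tsubst \<tau>) ts = map (tsubst \<tau>) us"
    using assms by (auto simp: a b)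
  then have len: "length ts = length us" by (metis length_map)
  have un: "unifies \<sigma> (zip ts us) \<longleftrightarrow> asubst \<sigma> a = asubst \<sigma> b" for \<sigma>
    by (simp add: a b PQ unifies_zip[OF len])
  obtain \<theta> where \<theta>: "strong_mgu \<theta> (zip ts us)"
    using strong_mgu_exists un assms by blast
  have mgu: "asubst \<theta> a = asubst \<theta> b" "\<And>\<sigma>. asubst \<sigma> a = asubst \<sigma> b \<Longrightarrow> subst_comp \<theta> \<sigma> = \<sigma>"
    using \<theta> by (auto simp: strong_mgu_def un)
  have "idempotent \<theta>" using mgu by (metis idempotent_def subst_comp_def)
  moreover have "is_mgu \<theta> a b"
    unfolding is_mgu_def unifier_def using mgu by (metis subst_comp_def)
  moreover have "relevant \<theta> a b"
    using \<theta> by (simp add: strong_mgu_def relevant_def evars_zip[OF len] a b)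
  ultimately show ?thesis using that mgu by blast
qed

text \<open>A renaming has to permute all variables, so \<open>A\<close> is exchanged with a fresh
  copy \<open>W\<close>. The exchange is an involution, hence bijective.\<close>

lemma fresh_bijection:
  fixes A V :: "'v set"
  assumes "infinite (UNIV :: 'v set)" "finite A" "finite V"
  obtains f where "bij f" "f ` A \<inter> V = {}"
proof -
  have "infinite (- (A \<union> V))" using assms by (simp add: Compl_eq_Diff_UNIV)
  then obtain W where W: "W \<subseteq> - (A \<union> V)" "card W = card A" "finite W"
    by (meson infinite_arbitrarily_large)
  then obtain g where g: "bij_betw g A W"
    using assms(2) finite_same_card_bij by metis
  define f where "f x = (if x \<in> A then g x else if x \<in> W then inv_into A g x else x)" for x
  have gA: "g x \<in> W" if "x \<in> A" for x using g that by (auto simp: bij_betw_def)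
  have gW: "inv_into A g x \<in> A" if "x \<in> W" for x
    using g that by (metis bij_betw_def inv_into_into)
  have "f (f x) = x" for x
    using gA gW W(1) g
    by (auto simp: f_def bij_betw_inv_into_left bij_betw_inv_into_right)
  then have "bij f" by (intro o_bij[of f f]) auto
  moreover have "f ` A \<inter> V = {}" using gA W(1) by (auto simp: f_def)
  ultimately show ?thesis using that by blast
qed

section \<open>Goals and stack-queue steps\<close>

lemma prios_simps:
  "prios (gsubst \<sigma> G) = prios G" "prios (gshift \<pi> G) = \<pi> ` prios G"
  "prios (F \<union> G) = prios F \<union> prios G"
  by (force simp: prios_def gsubst_def gshift_def)+

lemma gsubst_Var [simp]: "gsubst Var G = G"
  by (auto simp: gsubst_def)

lemma gshift_id [simp]: "gshift (\<lambda>x. x) G = G"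
  by (auto simp: gshift_def)

lemma pgoal_iff: "pgoal G \<longleftrightarrow> finite G \<and> (\<forall>x y p. (x,p) \<in> G \<longrightarrow> (y,p) \<in> G \<longrightarrow> x = y)"
  by (fastforce simp: pgoal_def inj_on_def)

lemma pgoal_gsubst: "pgoal G \<Longrightarrow> pgoal (gsubst \<sigma> G)"
  by (auto simp: pgoal_iff gsubst_def)

lemma pgoal_gshift: "pgoal G \<Longrightarrow> inj \<pi> \<Longrightarrow> pgoal (gshift \<pi> G)"
  by (auto simp: pgoal_iff gshift_def inj_eq)

lemma pgoal_Un: "pgoal F \<Longrightarrow> pgoal G \<Longrightarrow> nocommon F G \<Longrightarrow> pgoal (F \<union> G)"
  by (auto simp: pgoal_def nocommon_def prios_def inj_on_Un)

lemma pgoal_unique: "pgoal G \<Longrightarrow> (x,p) \<in> G \<Longrightarrow> (y,p) \<in> G \<Longrightarrow> x = y"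
  by (simp add: pgoal_iff)

lemma selects_unique:
  assumes "selects G a p K" "selects G a' p' K'"
  shows "a = a' \<and> p = p' \<and> K = K'"
proof -
  have "(a,p) = (a',p')"
  proof (rule ccontr)
    assume "(a,p) \<noteq> (a',p')"
    then have "p < p'" "p' < p" using assms by (force simp: selects_def before_def prios_def)+
    then show False by simp
  qed
  then show ?thesis using assms by (auto simp: selects_def)
qed

lemma selects_exists:
  assumes "pgoal G" "G \<noteq> {}"
  obtains a p K where "selects G a p K"
proof -
  have fin: "finite (prios G)" and ne: "prios G \<noteq> {}"
    using assms by (auto simp: pgoal_def prios_def)
  from Min_in[OF this] obtain a where a: "(a, Min (prios G)) \<in> G"
    by (force simp: prios_def)
  have *: "Min (prios G) < q" if "(b,q) \<in> G - {(a, Min (prios G))}" for b q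
  proof -
    have "Min (prios G) \<le> q" using that fin by (force simp: prios_def intro!: Min_le)
    moreover have "q \<noteq> Min (prios G)" using pgoal_unique[OF assms(1)] a that by blast
    ultimately show ?thesis by simp
  qed
  then have "selects G a (Min (prios G)) (G - {(a, Min (prios G))})"
    unfolding selects_def before_def using a *
    by (fastforce simp: prios_def[of "{_}"] prios_def[of "_ - _"] simp del: Diff_iff)
  then show ?thesis using that by blast
qed

lemma prios_rest:
  assumes "selects G a p K"
  shows "prios K = prios G - {p}" "p \<in> prios G" "\<And>q. q \<in> prios K \<Longrightarrow> p < q"
proof -
  have G: "G = insert (a,p) K" and K: "before {(a,p)} K" using assms by (auto simp: selects_def)
  show less: "p < q" if "q \<in> prios K" for q
    using K that by (auto simp: before_def prios_def)
  show "prios K = prios G - {p}" "p \<in> prios G"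
    using less by (auto simp: G prios_def)
qed

lemma is_step_iff:
  "is_step s \<longleftrightarrow> is_clause (st_cl s) \<and> pgoal (st_src s) \<and>
     (\<exists>a p F. selects (st_src s) a p F \<and> renaming (st_ren s) \<and>
        gvars (st_src s) \<inter> cvars (csubst (st_ren s) (st_cl s)) = {} \<and>
        idempotent (st_mgu s) \<and> relevant (st_mgu s) a (asubst (st_ren s) (fst (st_cl s))) \<and>
        is_mgu (st_mgu s) a (asubst (st_ren s) (fst (st_cl s))) \<and>
        shifting (st_shift s) \<and> nocommon F (gshift (st_shift s) (gsubst (st_ren s) (snd (st_cl s)))) \<and>
        st_res s = gsubst (st_mgu s) (F \<union> gshift (st_shift s) (gsubst (st_ren s) (snd (st_cl s)))))"
  by (cases s) (simp add: is_step_def)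

lemma is_stepD:
  assumes "is_step s" "selects (st_src s) a p K"
  shows "is_clause (st_cl s)" "pgoal (st_src s)" "shifting (st_shift s)"
    "asubst (st_mgu s) a = asubst (st_mgu s) (asubst (st_ren s) (fst (st_cl s)))"
    "nocommon K (gshift (st_shift s) (gsubst (st_ren s) (snd (st_cl s))))"
    "st_res s = gsubst (st_mgu s) (K \<union> gshift (st_shift s) (gsubst (st_ren s) (snd (st_cl s))))"
proof -
  obtain a' p' F where F: "selects (st_src s) a' p' F"
      "is_mgu (st_mgu s) a' (asubst (st_ren s) (fst (st_cl s)))"
      "nocommon F (gshift (st_shift s) (gsubst (st_ren s) (snd (st_cl s))))"
      "st_res s = gsubst (st_mgu s) (F \<union> gshift (st_shift s) (gsubst (st_ren s) (snd (st_cl s))))"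
    and s: "is_clause (st_cl s)" "pgoal (st_src s)" "shifting (st_shift s)"
    using assms(1) unfolding is_step_iff by (elim exE conjE) (rule that)
  show "is_clause (st_cl s)" "pgoal (st_src s)" "shifting (st_shift s)" by (fact s)+
  have "a' = a" "F = K" using selects_unique[OF assms(2) F(1)] by simp_all
  then show "asubst (st_mgu s) a = asubst (st_mgu s) (asubst (st_ren s) (fst (st_cl s)))"
    "nocommon K (gshift (st_shift s) (gsubst (st_ren s) (snd (st_cl s))))"
    "st_res s = gsubst (st_mgu s) (K \<union> gshift (st_shift s) (gsubst (st_ren s) (snd (st_cl s))))"
    using F by (simp_all add: is_mgu_def unifier_def)
qed

lemma is_step_selects:
  assumes "is_step s"
  obtains a p K where "selects (st_src s) a p K"
  using assms unfolding is_step_iff by (elim exE conjE) (rule that)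

lemma pgoal_rest: "pgoal G \<Longrightarrow> selects G a p K \<Longrightarrow> pgoal K"
  by (auto simp: pgoal_def selects_def inj_on_def)

lemma shifting_inj: "shifting \<pi> \<Longrightarrow> inj \<pi>"
  by (simp add: shifting_def bij_def)

lemma pgoal_st_res:
  assumes "is_step s"
  shows "pgoal (st_res s)"
proof -
  obtain a p K where sel: "selects (st_src s) a p K" using is_step_selects[OF assms] .
  note D = is_stepD[OF assms sel]
  have "pgoal (snd (st_cl s))" using D(1) by (simp add: is_clause_def)
  then show ?thesis unfolding D(6)
    by (intro pgoal_gsubst pgoal_Un pgoal_gshift pgoal_rest[OF D(2) sel] shifting_inj D(3,5))
qed

text \<open>Each map sends the largest element of \<open>A\<close> to the maximum of the common
  image; the induction peels this element off.\<close>

lemma strict_mono_image_eq: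
  fixes f g :: "rat \<Rightarrow> rat"
  assumes "finite A" "strict_mono f" "strict_mono g" "f ` A = g ` A" "x \<in> A"
  shows "f x = g x"
  using assms(1,4,5)
proof (induction A arbitrary: x rule: finite_linorder_max_induct)
  case (insert b A)
  have max: "Max (h ` insert b A) = h b" if "strict_mono h" for h :: "rat \<Rightarrow> rat"
    using insert.hyps that by (intro Max_eqI) (auto simp: strict_mono_less_eq less_imp_le)
  have fb: "f b = g b" using max[OF assms(2)] max[OF assms(3)] insert.prems(1) by simp
  have b: "h b \<notin> h ` A" if "strict_mono h" for h :: "rat \<Rightarrow> rat"
    using insert.hyps that by (auto simp: strict_mono_eq)
  have "f ` A = g ` A"
    using insert.prems(1) b[OF assms(2)] b[OF assms(3)] fb
    by (metis image_insert insert_ident)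
  then show ?case using insert fb by blast
qed auto

text \<open>\<open>stack_queue\<close> speaks about an existentially quantified shifting; comparing priorities shows that
  it agrees with the shifting of the step on the body, so the rule is a statement about priorities only.\<close>

definition obeys :: "rat set \<Rightarrow> rat set \<Rightarrow> (rat \<Rightarrow> rat) \<Rightarrow> rat set \<Rightarrow> bool" where
  "obeys T K \<pi> B \<longleftrightarrow> (\<forall>s\<in>B. \<forall>q\<in>K. if s \<in> T then \<pi> s < q else q < \<pi> s)"

lemma obeys_iff: "obeys T K \<pi> B \<Longrightarrow> s \<in> B \<Longrightarrow> q \<in> K \<Longrightarrow> s \<in> T \<longleftrightarrow> \<pi> s < q"
  using less_asym unfolding obeys_def by metis

text \<open>\<open>T\<close> depends on the clause alone. This is what makes a step and its later
  copy comparable although their surrounding goals and shiftings differ.\<close>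

lemma stack_queue_obeys:
  fixes SQ :: "('p,'f,'v) pstep set"
  assumes "stack_queue SQ"
  shows "\<exists>T :: ('p,'f,'v) clause \<Rightarrow> rat set. \<forall>s a p K. s \<in> SQ \<longrightarrow> selects (st_src s) a p K \<longrightarrow>
       obeys (T (st_cl s)) (prios K) (st_shift s) (prios (snd (st_cl s)))"
proof -
  have step: "is_step s" if "s \<in> SQ" for s
    using assms that by (auto simp: stack_queue_def complete_steps_def)
  have "\<exists>T. \<forall>s a p K. s \<in> SQ \<and> st_cl s = c \<and> selects (st_src s) a p K \<longrightarrow>
       obeys T (prios K) (st_shift s) (prios (snd c))" for c :: "('p,'f,'v) clause"
  proof -
    obtain Ms Mq where c: "snd c = Ms \<union> Mq" "before Ms Mq" and
      rule: "\<And>s. s \<in> SQ \<Longrightarrow> st_cl s = c \<Longrightarrow>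
           (\<exists>a p K \<gamma>. selects (st_src s) a p K \<and> shifting \<gamma> \<and>
              before (gshift \<gamma> (gsubst (st_ren s) Ms)) K \<and>
              before K (gshift \<gamma> (gsubst (st_ren s) Mq)) \<and>
              before (gshift \<gamma> (gsubst (st_ren s) Ms)) (gshift \<gamma> (gsubst (st_ren s) Mq)) \<and>
              st_res s = gsubst (st_mgu s)
                 (gshift \<gamma> (gsubst (st_ren s) Ms) \<union> K \<union> gshift \<gamma> (gsubst (st_ren s) Mq)))"
      using assms unfolding stack_queue_def by meson
    have "obeys (prios Ms) (prios K) (st_shift s) (prios (snd c))"
      if s: "s \<in> SQ" "st_cl s = c" "selects (st_src s) a p K" for s a p K
    proof -
      let ?B = "prios (snd c)"
      obtain \<gamma> where \<gamma>: "shifting \<gamma>" "before (gshift \<gamma> (gsubst (st_ren s) Ms)) K"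
        "before K (gshift \<gamma> (gsubst (st_ren s) Mq))"
        "st_res s = gsubst (st_mgu s)
           (gshift \<gamma> (gsubst (st_ren s) Ms) \<union> K \<union> gshift \<gamma> (gsubst (st_ren s) Mq))"
        using rule[OF s(1,2)] selects_unique[OF s(3)] by blast
      note D = is_stepD[OF step[OF s(1)] s(3)]
      have fin: "finite ?B" using D(1) s(2) by (auto simp: is_clause_def pgoal_def prios_def)
      have ord: "\<gamma> u < q" if "u \<in> prios Ms" "q \<in> prios K" for u q
        using \<gamma>(2) that by (auto simp: before_def prios_simps)
      have ord': "q < \<gamma> u" if "u \<in> prios Mq" "q \<in> prios K" for u q
        using \<gamma>(3) that by (auto simp: before_def prios_simps)
      \<comment> \<open>Two descriptions of the same resulting goal have the same priorities. Both
        shifted bodies avoid \<open>prios K\<close>, which therefore cancels.\<close>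
      have "prios K \<union> st_shift s ` ?B = prios K \<union> \<gamma> ` ?B"
        using arg_cong[where f=prios, OF trans[OF D(6)[symmetric] \<gamma>(4)]] s(2)
        by (auto simp: prios_simps c(1) image_Un)
      moreover have "prios K \<inter> st_shift s ` ?B = {}"
        using D(5) s(2) by (simp add: nocommon_def prios_simps)
      moreover have "prios K \<inter> \<gamma> ` ?B = {}"
        using ord ord' by (fastforce simp: c(1) prios_simps)
      ultimately have "st_shift s ` ?B = \<gamma> ` ?B" by blast
      then have "st_shift s u = \<gamma> u" if "u \<in> ?B" for u
        using strict_mono_image_eq[OF fin _ _ _ that] D(3) \<gamma>(1) by (auto simp: shifting_def)
      then show ?thesis using ord ord' by (auto simp: obeys_def c(1) prios_simps)
    qed
    then show ?thesis by blast
  qed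
  then have "\<exists>T. \<forall>c s a p K. s \<in> SQ \<and> st_cl s = c \<and> selects (st_src s) a p K \<longrightarrow>
       obeys (T c) (prios K) (st_shift s) (prios (snd c))"
    by (intro choice) blast
  then show ?thesis by blast
qed

text \<open>All that the simulation needs of a reduction is a map on priorities that sends each
  merged class to its minimum. Since \<tau> fixes the variables of \<open>N\<close>, the
  representatives and the untouched atoms are their own instances.\<close>

lemma reduced_map:
  assumes red: "reduced G \<tau> N X" and G: "pgoal G"
  obtains f where "\<And>x p. (x,p) \<in> G \<Longrightarrow> f p \<le> p \<and> (asubst \<tau> x, f p) \<in> N"
    "\<And>q. q \<in> prios N \<Longrightarrow> q \<in> prios G \<and> f q = q"
proof -
  obtain F and h :: nat and a p A where
    nc: "\<forall>j<h. nocommon F ({(a j, p j)} \<union> A j) \<and> nocommon {(a j, p j)} (A j)"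
      "\<forall>j<h. \<forall>k<h. j \<noteq> k \<longrightarrow> nocommon ({(a j, p j)} \<union> A j) ({(a k, p k)} \<union> A k)" and
    Geq: "G = F \<union> (\<Union>j<h. {(a j, p j)} \<union> A j)" and
    inst: "\<forall>j<h. \<forall>b s. (b, s) \<in> A j \<longrightarrow> asubst \<tau> b = a j" and
    Neq: "N = F \<union> (\<lambda>j. (a j, Min ({p j} \<union> prios (A j)))) ` {..<h}" and
    invar: "\<forall>x \<in> X \<union> gvars N. \<tau> x = Var x"
    using red unfolding reduced_def by (elim exE conjE) (rule that)
  note disjF = nc(1)[rule_format, THEN conjunct1] and disj = nc(2)[rule_format]
  define C where "C j = {p j} \<union> prios (A j)" for j
  have finC: "finite (C j)" if "j < h" for j
  proof -
    have "A j \<subseteq> G" using that by (auto simp: Geq)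
    then show ?thesis using G by (auto simp: C_def prios_def pgoal_def intro: finite_subset)
  qed
  have CF: "C j \<inter> prios F = {}" if "j < h" for j
    using disjF[OF that] by (auto simp: C_def nocommon_def prios_def)
  have CC: "C j \<inter> C k = {}" if "j < h" "k < h" "j \<noteq> k" for j k
    using disj[OF that] by (auto simp: C_def nocommon_def prios_def)
  have MinC: "Min (C j) \<in> C j" if "j < h" for j
    using finC[OF that] by (intro Min_in) (auto simp: C_def)
  have invN: "asubst \<tau> y = y" if "(y,r) \<in> N" for y r

  proof -
    have "asubst \<tau> y = asubst Var y"
      using invar that by (intro asubst_cong) (force simp: gvars_def)
    then show ?thesis by simp
  qed
  define f where "f q = (if q \<in> prios F then q else Min (C (THE j. j < h \<and> q \<in> C j)))" for q
  have fC: "f q = Min (C j)" if "j < h" "q \<in> C j" for q j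
  proof -
    have "(THE j. j < h \<and> q \<in> C j) = j" using that CC by (intro the_equality) blast+
    then show ?thesis using CF that by (auto simp: f_def)
  qed
  have "f q \<le> q \<and> (asubst \<tau> x, f q) \<in> N" if "(x,q) \<in> G" for x q
  proof (cases "(x,q) \<in> F")
    case True
    then show ?thesis using invN[of x q] by (force simp: f_def prios_def Neq)
  next
    case False
    then obtain j where j: "j < h" "(x,q) = (a j, p j) \<or> (x,q) \<in> A j"
      using \<open>(x,q) \<in> G\<close> Geq by auto
    then have q: "q \<in> C j" by (force simp: C_def prios_def)
    have aN: "(a j, Min (C j)) \<in> N" using j by (auto simp: Neq C_def)
    have "asubst \<tau> x = a j" using j inst invN[OF aN] by auto
    then show ?thesis using fC[OF j(1) q] finC[OF j(1)] q aN by simp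
  qed
  moreover have "q \<in> prios G \<and> f q = q" if "q \<in> prios N" for q
  proof (cases "q \<in> prios F")
    case True
    then show ?thesis by (auto simp: f_def Geq prios_simps)
  next
    case False
    then obtain j where j: "j < h" "q = Min (C j)" using \<open>q \<in> prios N\<close> by (auto simp: Neq prios_def C_def)
    have "C j \<subseteq> prios G" using j(1) by (force simp: C_def Geq prios_def)
    then show ?thesis using fC[OF j(1) MinC[OF j(1)]] MinC[OF j(1)] j(2) by auto
  qed
  ultimately show ?thesis using that by blast
qed

section \<open>Lifting\<close>

text \<open>The interface between lifting and simulation: the renaming and the unifier of a step are
  hidden, and only instances remain. Here \<delta> instantiates the old goal, \<mu> the original
  clause and \<delta>' the new goal.\<close>

definition expansion ::
  "rat set \<Rightarrow> ('p,'f,'v) pgoal \<Rightarrow> ('p,'f,'v) pgoal \<Rightarrow> (rat \<Rightarrow> rat) \<Rightarrow> ('f,'v) subst \<Rightarrow> ('f,'v) subst \<Rightarrow>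
   ('p,'f,'v) pgoal \<Rightarrow> ('f,'v) subst \<Rightarrow> bool" where
  "expansion T K B \<pi> \<delta> \<mu> H \<delta>' \<longleftrightarrow> pgoal H \<and> strict_mono \<pi> \<and> obeys T (prios K) \<pi> (prios B) \<and>
     prios H = prios K \<union> \<pi> ` prios B \<and>
     (\<forall>x q. (x,q) \<in> H \<longrightarrow> (\<exists>y. (y,q) \<in> K \<and> asubst \<delta>' x = asubst \<delta> y) \<or>
        (\<exists>y s. (y,s) \<in> B \<and> q = \<pi> s \<and> asubst \<delta>' x = asubst \<mu> y))"

text \<open>A translation works as soon as its length avoids the finitely many differences between
  the two sets.\<close>

lemma separating_shift:
  assumes "finite A" "finite (B :: rat set)"
  obtains \<pi> where "shifting \<pi>" "A \<inter> \<pi> ` B = {}"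
proof -
  have "finite ((\<lambda>(x,y). x - y) ` (A \<times> B))" using assms by auto
  then obtain L where L: "L \<notin> (\<lambda>(x,y). x - y) ` (A \<times> B)"
    using ex_new_if_finite infinite_UNIV_char_0 by blast
  have "bij (\<lambda>x. x + L)" by (intro o_bij[of "\<lambda>x. x - L"]) auto
  then have "shifting (\<lambda>x. x + L)" by (auto simp: shifting_def strict_mono_def)
  moreover have "A \<inter> (\<lambda>x. x + L) ` B = {}"
  proof (safe, goal_cases)
    case (1 _ y)
    then have "(\<lambda>(x,y). x - y) (y + L, y) \<in> (\<lambda>(x,y). x - y) ` (A \<times> B)" by blast
    then show ?case using L by simp
  qed
  ultimately show ?thesis using that by blast
qed

text \<open>Replacing the renaming and the unifier but not the shifting yields steps that are
  congruent lowerings of each other, with the identity as witnessing shifting.\<close>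

lemma complete_steps_change_renaming:
  assumes S: "complete_steps S" and s: "s \<in> S" and s': "is_step s'"
    and eq: "st_src s' = st_src s" "st_cl s' = st_cl s" "st_shift s' = st_shift s"
  shows "s' \<in> S"
proof -
  have step: "is_step s" using S s by (auto simp: complete_steps_def)
  obtain a p K where sel: "selects (st_src s) a p K" using is_step_selects[OF step] .
  have sh: "shifting (\<lambda>x. x)" by (auto simp: shifting_def strict_mono_def bij_def inj_on_def)
  have cl: "congruent_lowering u v"
    if u: "is_step u" and v: "is_step v" and uv: "st_src u = st_src v" "st_cl u = st_cl v"
      "st_shift u = st_shift v" "selects (st_src v) a p K" for u v
  proof -
    have "lowering_wit u v {} Var (\<lambda>x. x) K a p"
      using u v sh uv is_stepD(6)[OF v uv(4)] is_stepD(6)[OF u uv(4)[folded uv(1)]]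
      by (simp add: lowering_wit_def nocommon_def prios_def)
    then show ?thesis
      unfolding congruent_lowering_def using sh uv(3)
      by (intro exI conjI) (assumption, rule sh, simp_all)
  qed
  have "congruent_each_other s' s"
    using cl[OF s' step] cl[OF step s'] eq sel by (simp add: congruent_each_other_def)
  then show ?thesis using S s by (auto simp: complete_steps_def)
qed

lemma gvars_cover: "(x,q) \<in> G \<Longrightarrow> avars x \<subseteq> gvars G"
  by (force simp: gvars_def)

text \<open>Completeness is used twice: it provides some step for this source and clause, and it
  keeps that step in \<open>SQ\<close> after its renaming and unifier have been exchanged for a
  fresh renaming and a suitable unifier.\<close>

lemma lifting_step:
  fixes c :: "('p,'f,'v) clause"
  assumes inf: "infinite (UNIV :: 'v set)" and SQ: "complete_steps SQ"
    and T: "\<And>s a p K. s \<in> SQ \<Longrightarrow> selects (st_src s) a p K \<Longrightarrow>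
       obeys (T (st_cl s)) (prios K) (st_shift s) (prios (snd (st_cl s)))"
    and c: "is_clause c" and H: "pgoal H" and sel: "selects H b p K"
    and unif: "asubst \<delta> b = asubst \<mu> (fst c)" and V: "finite V"
  obtains s \<delta>' where "s \<in> SQ" "st_src s = H" "st_cl s = c" "renamed_vars s \<inter> V = {}"
    "expansion (T c) K (snd c) (st_shift s) \<delta> \<mu> (st_res s) \<delta>'"
proof -
  have finB: "finite (snd c)" and finH: "finite H" using c H by (auto simp: is_clause_def pgoal_def)
  have finc: "finite (cvars c)" using finB by (simp add: cvars_def finite_avars finite_gvars)
  obtain f where f: "bij f" "f ` cvars c \<inter> (V \<union> gvars H) = {}"
    using fresh_bijection[OF inf finc, of "V \<union> gvars H"] V finite_gvars[OF finH] by auto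
  define \<xi> :: "('f,'v) subst" where "\<xi> = (\<lambda>x. Var (f x))"
  have ren: "renaming \<xi>" using f(1) by (auto simp: renaming_def \<xi>_def)
  have vars: "cvars (csubst \<xi> c) = f ` cvars c"
    by (force simp: cvars_def csubst_def gvars_def gsubst_def avars_asubst \<xi>_def)
  \<comment> \<open>The renamed clause shares no variable with \<open>H\<close>, so the instances of
    goal and clause combine into a single unifier; \<open>inv f\<close> undoes the renaming.\<close>
  define \<sigma> where "\<sigma> x = (if x \<in> f ` cvars c then \<mu> (inv f x) else \<delta> x)" for x
  have \<sigma>H: "asubst \<sigma> x = asubst \<delta> x" if "(x,q) \<in> H" for x q
  proof (rule asubst_cong)
    fix y assume "y \<in> avars x"
    then have "y \<in> gvars H" using gvars_cover that by blast
    then show "\<sigma> y = \<delta> y" using f(2) by (auto simp: \<sigma>_def)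
  qed
  have \<sigma>c: "asubst \<sigma> (asubst \<xi> y) = asubst \<mu> y" if "avars y \<subseteq> cvars c" for y :: "('p,'f,'v) atom"
    unfolding asubst_subst_comp using that f(1)
    by (intro asubst_cong) (auto simp: subst_comp_def \<xi>_def \<sigma>_def bij_is_inj)
  have "asubst \<sigma> b = asubst \<sigma> (asubst \<xi> (fst c))"
    using unif \<sigma>H sel \<sigma>c[of "fst c"] by (auto simp: selects_def cvars_def)
  then obtain \<theta> where \<theta>: "idempotent \<theta>" "relevant \<theta> b (asubst \<xi> (fst c))"
      "is_mgu \<theta> b (asubst \<xi> (fst c))" "subst_comp \<theta> \<sigma> = \<sigma>"
    using relevant_mgu_exists by metis
  define st where "st \<pi> = Step H c \<xi> \<theta> \<pi> (gsubst \<theta> (K \<union> gshift \<pi> (gsubst \<xi> (snd c))))" for \<pi>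
  have step: "is_step (st \<pi>)" if "shifting \<pi>" "nocommon K (gshift \<pi> (gsubst \<xi> (snd c)))" for \<pi>
  proof -
    have "gvars H \<inter> cvars (csubst \<xi> c) = {}" using f(2) vars by blast
    then show ?thesis
      unfolding is_step_iff st_def pstep.sel using c H sel ren \<theta> that
      by (intro conjI exI[of _ b] exI[of _ p] exI[of _ K]) (assumption | rule refl)+
  qed
  \<comment> \<open>This shifting only shows that some step exists; the member of \<open>SQ\<close>
    obtained from it may have a different one.\<close>
  obtain \<pi>\<^sub>0 where "shifting \<pi>\<^sub>0" "prios K \<inter> \<pi>\<^sub>0 ` prios (snd c) = {}"
    using separating_shift[of "prios K" "prios (snd c)"] finB finH sel
    by (auto simp: prios_def selects_def)
  then have "is_step (st \<pi>\<^sub>0)" by (intro step) (auto simp: nocommon_def prios_simps)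
  then obtain s\<^sub>0 where s\<^sub>0: "s\<^sub>0 \<in> SQ" "st_src s\<^sub>0 = H" "st_cl s\<^sub>0 = c"
    using SQ unfolding complete_steps_def by (metis st_def pstep.sel(1,2))
  \<comment> \<open>The shifting dictated by the rule is kept, and the fresh renaming and \<theta>
    are put back.\<close>
  define s where "s = st (st_shift s\<^sub>0)"
  have s\<^sub>0_step: "is_step s\<^sub>0" using SQ s\<^sub>0 by (auto simp: complete_steps_def)
  have "shifting (st_shift s\<^sub>0)" "nocommon K (gshift (st_shift s\<^sub>0) (gsubst \<xi> (snd c)))"
    using is_stepD[OF s\<^sub>0_step, of b p K] s\<^sub>0 sel by (auto simp: nocommon_def prios_simps)
  then have s_step: "is_step s" unfolding s_def by (rule step)
  have s: "s \<in> SQ"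
    using complete_steps_change_renaming[OF SQ s\<^sub>0(1) s_step] s\<^sub>0 by (simp add: s_def st_def)
  have s_sel: "st_src s = H" "st_cl s = c" "st_ren s = \<xi>" "st_mgu s = \<theta>" by (auto simp: s_def st_def)
  have res: "st_res s = gsubst \<theta> (K \<union> gshift (st_shift s) (gsubst \<xi> (snd c)))"
    using is_stepD(6)[OF s_step, of b p K] sel s_sel by simp
  have "expansion (T c) K (snd c) (st_shift s) \<delta> \<mu> (st_res s) \<sigma>"
    unfolding expansion_def
  proof (intro conjI allI impI)
    show "pgoal (st_res s)" by (rule pgoal_st_res[OF s_step])
    show "strict_mono (st_shift s)"
      using is_stepD(3)[OF s_step, of b p K] sel s_sel by (simp add: shifting_def)
    show "obeys (T c) (prios K) (st_shift s) (prios (snd c))"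
      using T[OF s, of b p K] sel s_sel by simp
    show "prios (st_res s) = prios K \<union> st_shift s ` prios (snd c)"
      by (simp add: res prios_simps)
    fix x q assume "(x,q) \<in> st_res s"
    then consider y where "(y,q) \<in> K" "x = asubst \<theta> y"
      | y u where "(y,u) \<in> snd c" "q = st_shift s u" "x = asubst \<theta> (asubst \<xi> y)"
      unfolding res by (auto simp: gsubst_def gshift_def)
    then show "(\<exists>y. (y,q) \<in> K \<and> asubst \<sigma> x = asubst \<delta> y) \<or>
        (\<exists>y u. (y,u) \<in> snd c \<and> q = st_shift s u \<and> asubst \<sigma> x = asubst \<mu> y)"
    proof cases
      case 1
      then have "asubst \<sigma> x = asubst \<delta> y"
        using \<sigma>H[of y q] sel \<theta>(4) by (simp add: asubst_subst_comp selects_def)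
      then show ?thesis using 1 by blast
    next
      case 2
      have "asubst \<sigma> x = asubst \<sigma> (asubst \<xi> y)"
        using 2 asubst_subst_comp[of \<sigma> \<theta> "asubst \<xi> y"] \<theta>(4) by simp
      also have "\<dots> = asubst \<mu> y"
        using gvars_cover[OF 2(1)] by (intro \<sigma>c) (auto simp: cvars_def)
      finally show ?thesis using 2 by blast
    qed
  qed
  moreover have "renamed_vars s \<inter> V = {}"
    using f(2) vars s_sel by (auto simp: renamed_vars_def)
  ultimately show ?thesis using that s s_sel by blast
qed

section \<open>Simulating a reduced derivation\<close>

datatype tracker = Current rat | Resolved nat

text \<open>\<open>red j\<close> maps a priority of the goal that step \<open>j\<close> produces to the priority of the atom it is merged
  into; \<open>\<omega> j\<close> is the unifier of step \<open>j\<close> followed by the reducing substitution.\<close>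

locale reduced_trace =
  fixes N :: "nat \<Rightarrow> ('p,'f,'v) pgoal" and sel :: "nat \<Rightarrow> ('p,'f,'v) atom" and pr :: "nat \<Rightarrow> rat"
    and K :: "nat \<Rightarrow> ('p,'f,'v) pgoal" and c :: "nat \<Rightarrow> ('p,'f,'v) clause"
    and \<xi> :: "nat \<Rightarrow> ('f,'v) subst" and \<pi> :: "nat \<Rightarrow> rat \<Rightarrow> rat" and \<omega> :: "nat \<Rightarrow> ('f,'v) subst"
    and red :: "nat \<Rightarrow> rat \<Rightarrow> rat" and T :: "('p,'f,'v) clause \<Rightarrow> rat set"
  assumes pgoal_N: "pgoal (N j)"
    and selects_N: "selects (N j) (sel j) (pr j) (K j)"
    and obeys_N: "obeys (T (c j)) (prios (K j)) (\<pi> j) (prios (snd (c j)))"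
    and mono_shift: "strict_mono (\<pi> j)"
    and head: "asubst (\<omega> j) (sel j) = asubst (\<omega> j) (asubst (\<xi> j) (fst (c j)))"
    and kept: "(y,q) \<in> K j \<Longrightarrow> red j q \<le> q \<and> (asubst (\<omega> j) y, red j q) \<in> N (Suc j)"
    and added: "(y,s) \<in> snd (c j) \<Longrightarrow>
      red j (\<pi> j s) \<le> \<pi> j s \<and> (asubst (\<omega> j) (asubst (\<xi> j) y), red j (\<pi> j s)) \<in> N (Suc j)"
    and prios_N: "q \<in> prios (N (Suc j)) \<Longrightarrow> q \<in> prios (K j) \<union> \<pi> j ` prios (snd (c j)) \<and> red j q = q"
begin

fun update :: "nat \<Rightarrow> tracker \<Rightarrow> tracker" where
  "update j (Current q) = (if q = pr j then Resolved j else Current (red j q))"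
| "update j (Resolved t) = Resolved t"

text \<open>\<open>child j t s\<close> is the fate at stage \<open>j\<close> of the body atom of priority \<open>s\<close> introduced at step
  \<open>t\<close>, and \<open>inst j t\<close> is the substitution accumulated since then; both are meaningful only for
  \<open>t < j\<close>.\<close>

fun child :: "nat \<Rightarrow> nat \<Rightarrow> rat \<Rightarrow> tracker" where
  "child 0 t s = Resolved t"
| "child (Suc j) t s = (if t = j then Current (red j (\<pi> j s)) else update j (child j t s))"

fun inst :: "nat \<Rightarrow> nat \<Rightarrow> ('f,'v) subst" where
  "inst 0 t = Var"
| "inst (Suc j) t = (if t = j then \<omega> j else subst_comp (inst j t) (\<omega> j))"

fun denotes :: "nat \<Rightarrow> tracker \<Rightarrow> ('p,'f,'v) atom \<Rightarrow> bool" where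
  "denotes j (Current q) x \<longleftrightarrow> (x,q) \<in> N j"
| "denotes j (Resolved t) x \<longleftrightarrow> t < j \<and> x = asubst (inst j t) (sel t)"

lemma sel_in_N: "(sel j, pr j) \<in> N j" and N_cases: "(y,q) \<in> N j \<Longrightarrow> (y,q) = (sel j, pr j) \<or> (y,q) \<in> K j"
  using selects_N[of j] by (auto simp: selects_def)

lemma K_prios:
  "prios (K j) = prios (N j) - {pr j}" "pr j \<in> prios (N j)"
  "q \<in> prios (N j) \<Longrightarrow> q \<noteq> pr j \<Longrightarrow> pr j < q"
  using prios_rest[OF selects_N[of j]] by auto

lemma denotes_update:
  assumes "denotes j x y"
  shows "denotes (Suc j) (update j x) (asubst (\<omega> j) y)"
proof (cases x)
  case (Current q)
  show ?thesis
  proof (cases "q = pr j")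
    case True
    then have "y = sel j" using pgoal_unique[OF pgoal_N[of j]] sel_in_N assms Current by auto
    then show ?thesis using True Current by simp
  next
    case False
    then have "(y,q) \<in> K j" using N_cases assms Current by auto
    then show ?thesis using kept False Current by simp
  qed
next
  case (Resolved t)
  then show ?thesis using assms by (simp add: asubst_subst_comp)
qed

lemma denotes_child:
  "t < j \<Longrightarrow> (y,s) \<in> snd (c t) \<Longrightarrow> denotes j (child j t s) (asubst (inst j t) (asubst (\<xi> t) y))"
proof (induction j)
  case (Suc j)
  show ?case
  proof (cases "t = j")
    case True
    then show ?thesis using added Suc.prems by simp
  next
    case False
    then have "denotes j (child j t s) (asubst (inst j t) (asubst (\<xi> t) y))" using Suc by simp
    from denotes_update[OF this] show ?thesis
      using False by (simp add: asubst_subst_comp[symmetric])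
  qed
qed simp

text \<open>This is why step \<open>t\<close> can be repeated later: later substitutions preserve
  the agreement of the resolved atom with the clause head.\<close>

lemma head_inst: "t < j \<Longrightarrow> asubst (inst j t) (sel t) = asubst (inst j t) (asubst (\<xi> t) (fst (c t)))"
proof (induction j)
  case (Suc j)
  then show ?case
    using head[of j] by (cases "t = j") (simp_all add: asubst_subst_comp[symmetric])
qed simp

definition valid :: "nat \<Rightarrow> tracker \<Rightarrow> bool" where
  "valid j x \<longleftrightarrow> (\<exists>y. denotes j x y)"

lemma valid_simps [simp]:
  "valid j (Current q) \<longleftrightarrow> q \<in> prios (N j)" "valid j (Resolved t) \<longleftrightarrow> t < j"
  by (force simp: valid_def prios_def)+

lemma valid_child: "t < j \<Longrightarrow> s \<in> prios (snd (c t)) \<Longrightarrow> valid j (child j t s)"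
  using denotes_child unfolding valid_def prios_def by fastforce

section \<open>Reachability through stack parts\<close>

definition stack_prios :: "nat \<Rightarrow> rat set" where
  "stack_prios t = prios (snd (c t)) \<inter> T (c t)"

text \<open>These are the trackers that copying step \<open>t\<close> can bring ahead of the rest of
  the goal, where resolved stack atoms are copied in turn. Queue parts are left out, since they land
  behind the rest.\<close>

inductive reach :: "nat \<Rightarrow> nat \<Rightarrow> tracker \<Rightarrow> bool" for j where
  base: "s \<in> stack_prios t \<Longrightarrow> reach j t (child j t s)"
| step: "reach j t (Resolved u) \<Longrightarrow> s \<in> stack_prios u \<Longrightarrow> reach j t (child j u s)"

lemma reach_trans: "reach j u x \<Longrightarrow> reach j t (Resolved u) \<Longrightarrow> reach j t x"
  by (induction rule: reach.induct) (auto intro: reach.intros)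

lemma reach_valid: "reach j t x \<Longrightarrow> t < j \<Longrightarrow> valid j x"
  by (induction rule: reach.induct) (auto intro: valid_child simp: stack_prios_def)

text \<open>Immediately after step \<open>j\<close> its whole body is still unresolved, so the rule
  \<open>step\<close> never applies.\<close>

lemma reach_last: "reach (Suc j) t x \<Longrightarrow> t = j \<Longrightarrow> \<exists>s\<in>stack_prios j. x = Current (red j (\<pi> j s))"
  by (induction rule: reach.induct) auto

text \<open>The only tracker that newly becomes resolved is that of the atom selected at step
  \<open>j\<close>. New paths must pass through it, and they stop at once, because its stack
  children are still current.\<close>

lemma reach_Suc:
  "reach (Suc j) t x \<Longrightarrow> t < j \<Longrightarrow> (\<exists>y. reach j t y \<and> x = update j y) \<or>
     (reach j t (Current (pr j)) \<and> (\<exists>s\<in>stack_prios j. x = Current (red j (\<pi> j s))))"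
proof (induction rule: reach.induct)
  case (base s t)
  then have "child (Suc j) t s = update j (child j t s)" by simp
  then show ?case using reach.base[OF base(1), of j] by blast
next
  case (step t u s)
  then obtain y where y: "reach j t y" "Resolved u = update j y" by auto
  show ?case
  proof (cases y)
    case (Current q)
    then have "q = pr j" "u = j" using y(2) by (auto split: if_splits)
    then show ?thesis using y(1) Current step.hyps(2) by auto
  next
    case (Resolved v)
    then have r: "reach j t (Resolved u)" using y by simp
    then have "u < j" using reach_valid step.prems by fastforce
    then have "child (Suc j) u s = update j (child j u s)" by simp
    then show ?thesis using reach.step[OF r step.hyps(2)] by blast
  qed
qed

definition tracked_before :: "('p,'f,'v) pgoal \<Rightarrow> (rat \<Rightarrow> tracker) \<Rightarrow> rat \<Rightarrow> rat \<Rightarrow> bool" where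
  "tracked_before H \<tau> p q \<longleftrightarrow> (\<exists>p'\<in>prios H. p' < p \<and> \<tau> p' = Current q)"

text \<open>The last condition expresses that an atom copying an already resolved one is preceded by all the
  unresolved atoms that its stack parts can reproduce: when such an atom is selected, the atoms
  which the copied step pushes have all been resolved, too.\<close>

definition simulates :: "nat \<Rightarrow> ('p,'f,'v) pgoal \<Rightarrow> (rat \<Rightarrow> tracker) \<Rightarrow> ('f,'v) subst \<Rightarrow> bool" where
  "simulates j H \<tau> \<delta> \<longleftrightarrow> pgoal H \<and>
     (\<forall>x p. (x,p) \<in> H \<longrightarrow> denotes j (\<tau> p) (asubst \<delta> x)) \<and>
     (\<forall>q\<in>prios (N j). \<exists>p\<in>prios H. \<tau> p = Current q) \<and>
     (\<forall>p\<in>prios H. \<forall>r. \<forall>q\<in>prios (N j). \<tau> p = Current r \<longrightarrow> q < r \<longrightarrow> tracked_before H \<tau> p q) \<and>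
     (\<forall>p\<in>prios H. \<forall>t q. \<tau> p = Resolved t \<longrightarrow> reach j t (Current q) \<longrightarrow> tracked_before H \<tau> p q)"

lemma simulatesD:
  assumes "simulates j H \<tau> \<delta>"
  shows "pgoal H"
    "\<And>x p. (x,p) \<in> H \<Longrightarrow> denotes j (\<tau> p) (asubst \<delta> x)"
    "\<And>q. q \<in> prios (N j) \<Longrightarrow> \<exists>p\<in>prios H. \<tau> p = Current q"
    "\<And>p r q. p \<in> prios H \<Longrightarrow> \<tau> p = Current r \<Longrightarrow> q \<in> prios (N j) \<Longrightarrow> q < r \<Longrightarrow>
       \<exists>p'\<in>prios H. p' < p \<and> \<tau> p' = Current q"
    "\<And>p t q. p \<in> prios H \<Longrightarrow> \<tau> p = Resolved t \<Longrightarrow> reach j t (Current q) \<Longrightarrow>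
       \<exists>p'\<in>prios H. p' < p \<and> \<tau> p' = Current q"
  using assms unfolding simulates_def tracked_before_def by blast+

text \<open>If the first atom tracked a current priority above \<open>pr j\<close>, the order
  condition would put a tracker of \<open>pr j\<close> before it.\<close>

lemma selected_tracker:
  assumes sim: "simulates j H \<tau> \<delta>" and sel: "selects H b p K'"
  shows "\<tau> p = Current (pr j) \<or> (\<exists>t<j. \<tau> p = Resolved t)"
proof -
  note D = simulatesD[OF sim] and P = prios_rest[OF sel]
  have "valid j (\<tau> p)" using D(2)[of b p] sel by (auto simp: valid_def selects_def)
  moreover have "r = pr j" if r: "\<tau> p = Current r" for r
  proof (rule ccontr)
    assume "r \<noteq> pr j"
    then have "pr j < r" using K_prios(3)[of r j] calculation r by simp
    then obtain p' where "p' \<in> prios H" "p' < p" using D(4)[OF P(2) r K_prios(2)] by blast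
    then show False using P(1,3) by force
  qed
  ultimately show ?thesis by (cases "\<tau> p") auto
qed

section \<open>Preservation of the invariant by copying and by advancing\<close>

definition glue :: "('p,'f,'v) pgoal \<Rightarrow> (rat \<Rightarrow> tracker) \<Rightarrow> (rat \<Rightarrow> rat) \<Rightarrow> nat \<Rightarrow> nat \<Rightarrow> rat \<Rightarrow> tracker" where
  "glue K' \<tau> \<pi>' j t q = (if q \<in> prios K' then \<tau> q else child j t (inv \<pi>' q))"

text \<open>Serves both kinds of simulating step: copying step \<open>t\<close> at a stage
  \<open>j\<close>, and advancing, where the stage is the successor of \<open>t\<close>.\<close>

lemma expansion_glue:
  assumes ex: "expansion (T (c t)) K' (snd (c t)) \<pi>' \<delta> (subst_comp (\<xi> t) (inst j t)) H' \<delta>'" and t: "t < j"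
    and K': "\<forall>x q. (x,q) \<in> K' \<longrightarrow> denotes j (\<tau> q) (asubst \<delta> x)"
  shows "\<And>q. q \<in> prios K' \<Longrightarrow> glue K' \<tau> \<pi>' j t q = \<tau> q"
    "\<And>s. s \<in> prios (snd (c t)) \<Longrightarrow> glue K' \<tau> \<pi>' j t (\<pi>' s) = child j t s"
    "\<And>x q. (x,q) \<in> H' \<Longrightarrow> denotes j (glue K' \<tau> \<pi>' j t q) (asubst \<delta>' x)"
proof -
  have mono: "strict_mono \<pi>'" and ob: "obeys (T (c t)) (prios K') \<pi>' (prios (snd (c t)))"
    and H': "\<And>x q. (x,q) \<in> H' \<Longrightarrow> (\<exists>y. (y,q) \<in> K' \<and> asubst \<delta>' x = asubst \<delta> y) \<or>
        (\<exists>y s. (y,s) \<in> snd (c t) \<and> q = \<pi>' s \<and> asubst \<delta>' x = asubst (subst_comp (\<xi> t) (inst j t)) y)"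
    using ex unfolding expansion_def by blast+
  show 1: "glue K' \<tau> \<pi>' j t q = \<tau> q" if "q \<in> prios K'" for q using that by (simp add: glue_def)
  show 2: "glue K' \<tau> \<pi>' j t (\<pi>' s) = child j t s" if "s \<in> prios (snd (c t))" for s
  proof -
    \<comment> \<open>A common priority would, by \<open>obeys\<close>, be strictly smaller than
      itself.\<close>
    have "\<pi>' s \<notin> prios K'" using ob that by (auto simp: obeys_def split: if_splits)
    then show ?thesis using strict_mono_imp_inj_on[OF mono] by (simp add: glue_def)
  qed
  fix x q assume "(x,q) \<in> H'"
  from H'[OF this] show "denotes j (glue K' \<tau> \<pi>' j t q) (asubst \<delta>' x)"
  proof (elim disjE exE conjE)
    fix y assume y: "(y,q) \<in> K'" "asubst \<delta>' x = asubst \<delta> y"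
    then have "q \<in> prios K'" by (force simp: prios_def)
    then show ?thesis using 1 K' y by simp
  next
    fix y s assume y: "(y,s) \<in> snd (c t)" "q = \<pi>' s"
      "asubst \<delta>' x = asubst (subst_comp (\<xi> t) (inst j t)) y"
    then have "s \<in> prios (snd (c t))" by (force simp: prios_def)
    then show ?thesis using 2 denotes_child[OF t y(1)] y by (simp add: asubst_subst_comp)
  qed
qed

lemma simulates_resolved:
  assumes sim: "simulates j H \<tau> \<delta>" and sel: "selects H b p K'" and t: "\<tau> p = Resolved t" "t < j"
    and ex: "expansion (T (c t)) K' (snd (c t)) \<pi>' \<delta> (subst_comp (\<xi> t) (inst j t)) H' \<delta>'"
  shows "simulates j H' (glue K' \<tau> \<pi>' j t) \<delta>'"
proof -
  let ?B = "prios (snd (c t))" and ?\<tau> = "glue K' \<tau> \<pi>' j t"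
  note D = simulatesD[OF sim] and P = prios_rest[OF sel]
  have "\<forall>x q. (x,q) \<in> K' \<longrightarrow> denotes j (\<tau> q) (asubst \<delta> x)"
    using sel D(2) by (auto simp: selects_def)
  note G = expansion_glue[OF ex t(2) this]
  have ob: "obeys (T (c t)) (prios K') \<pi>' ?B" and H': "prios H' = prios K' \<union> \<pi>' ` ?B" "pgoal H'"
    using ex unfolding expansion_def by blast+
  \<comment> \<open>The removed position \<open>p\<close> tracks a resolved atom, so no tracker of a
    current atom is lost.\<close>
  have tracked: "\<exists>p'\<in>prios K'. \<tau> p' = Current q" if "q \<in> prios (N j)" for q
    using D(3)[OF that] P(1) t(1) by force
  \<comment> \<open>The invariant would put a tracker before \<open>p\<close>, but \<open>p\<close>
    is the first position of \<open>H\<close>.\<close>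
  have no_reach: "\<not> reach j t (Current q)" for q
    using D(5)[OF P(2) t(1)] P(1,3) by force
  have stack: "\<not> reach j u (Current q)" if "s \<in> ?B" "s \<in> T (c t)" "child j t s = Resolved u" for s u q
  proof
    assume "reach j u (Current q)"
    moreover have "reach j t (Resolved u)"
      using reach.base[where s = s and t = t and j = j] that by (simp add: stack_prios_def)
    ultimately show False using reach_trans no_reach by blast
  qed
  have queue: "tracked_before H' ?\<tau> (\<pi>' s) q" if s: "s \<in> ?B" "s \<notin> T (c t)" and q: "q \<in> prios (N j)" for s q
  proof -
    obtain p' where p': "p' \<in> prios K'" "\<tau> p' = Current q" using tracked[OF q] by blast
    then have "p' < \<pi>' s" using ob s by (auto simp: obeys_def)
    then show ?thesis using p' H' G(1) by (auto simp: tracked_before_def)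
  qed
  have old: "tracked_before H' ?\<tau> p1 q" if p': "p' \<in> prios H" "p' < p1" "\<tau> p' = Current q" for p1 p' q
  proof -
    have "p' \<noteq> p" using p'(3) t(1) by force
    then have "p' \<in> prios K'" using p'(1) P(1) by simp
    then show ?thesis using p'(2,3) H'(1) G(1) unfolding tracked_before_def by (intro bexI[of _ p']) simp_all
  qed
  show ?thesis unfolding simulates_def
  proof (intro conjI allI impI ballI)
    show "pgoal H'" by fact
    show "denotes j (?\<tau> q) (asubst \<delta>' x)" if "(x,q) \<in> H'" for x q by (rule G(3)[OF that])
    show "\<exists>p\<in>prios H'. ?\<tau> p = Current q" if "q \<in> prios (N j)" for q
      using tracked[OF that] H'(1) G(1) by (metis UnI1)
    fix p1 assume p1: "p1 \<in> prios H'"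
    show "tracked_before H' ?\<tau> p1 q" if q: "q \<in> prios (N j)" and r: "?\<tau> p1 = Current r" "q < r" for r q
    proof (cases "p1 \<in> prios K'")
      case True
      then have "p1 \<in> prios H" "\<tau> p1 = Current r" using P(1) G(1) r by auto
      then show ?thesis using D(4)[OF _ _ q r(2)] old by blast
    next
      case False
      then obtain s where s: "s \<in> ?B" "p1 = \<pi>' s" using p1 H' by auto
      then have "child j t s = Current r" using G(2) r(1) by simp
      then have "s \<notin> T (c t)" using no_reach reach.base[where s = s and t = t and j = j] s by (auto simp: stack_prios_def)
      then show ?thesis using queue s q by simp
    qed
    show "tracked_before H' ?\<tau> p1 q" if u: "?\<tau> p1 = Resolved u" "reach j u (Current q)" for u q
    proof (cases "p1 \<in> prios K'")
      case True
      then have "p1 \<in> prios H" "\<tau> p1 = Resolved u" using P(1) G(1) u by auto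
      then show ?thesis using D(5)[OF _ _ u(2)] old by blast
    next
      case False
      then obtain s where s: "s \<in> ?B" "p1 = \<pi>' s" using p1 H' by auto
      then have cu: "child j t s = Resolved u" using G(2) u(1) by simp
      then have "u < j" using valid_child[OF t(2) s(1)] by simp
      then have "q \<in> prios (N j)" using reach_valid[OF u(2)] by simp
      moreover have "s \<notin> T (c t)" using stack[OF s(1) _ cu] u(2) by blast
      ultimately show ?thesis using queue s by simp
    qed
  qed
qed

text \<open>Both derivations apply the clause of step \<open>j\<close> under different shiftings.
  The order between body and rest is decided by the same split on both sides, and the order inside
  the body by monotonicity. Merging only lowers priorities, so an atom preceding a representative
  also precedes everything merged into it.\<close>

lemma simulates_current:
  assumes sim: "simulates j H \<tau> \<delta>" and sel: "selects H b p K'" and cur: "\<tau> p = Current (pr j)"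
    and ex: "expansion (T (c j)) K' (snd (c j)) \<pi>' (subst_comp \<delta> (\<omega> j))
      (subst_comp (\<xi> j) (inst (Suc j) j)) H' \<delta>'"
  shows "simulates (Suc j) H' (glue K' (\<lambda>q. update j (\<tau> q)) \<pi>' (Suc j) j) \<delta>'"
proof -
  let ?B = "prios (snd (c j))" and ?\<tau> = "glue K' (\<lambda>q. update j (\<tau> q)) \<pi>' (Suc j) j"
  note D = simulatesD[OF sim] and P = prios_rest[OF sel]
  have "\<forall>x q. (x,q) \<in> K' \<longrightarrow> denotes (Suc j) (update j (\<tau> q)) (asubst (subst_comp \<delta> (\<omega> j)) x)"
    using sel D(2) denotes_update by (auto simp: selects_def asubst_subst_comp[symmetric])
  note G = expansion_glue[OF ex lessI this]
  have ob: "obeys (T (c j)) (prios K') \<pi>' ?B" and H': "prios H' = prios K' \<union> \<pi>' ` ?B" "pgoal H'"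
    and mono: "strict_mono \<pi>'"
    using ex unfolding expansion_def by blast+
  have child: "?\<tau> (\<pi>' s) = Current (red j (\<pi> j s))" if "s \<in> ?B" for s
    using G(2)[OF that] by simp
  have old: "tracked_before H' ?\<tau> p1 (red j q)"
    if p': "p' \<in> prios H" "p' < p1" "\<tau> p' = Current q" "q \<noteq> pr j" for p1 p' q
  proof -
    have "p' \<noteq> p" using p'(3,4) cur by force
    then have "p' \<in> prios K'" using p'(1) P(1) by simp
    then show ?thesis using p'(2-4) H'(1) G(1) unfolding tracked_before_def by (intro bexI[of _ p']) simp_all
  qed
  have body: "tracked_before H' ?\<tau> p1 (red j (\<pi> j s))" if "s \<in> ?B" "\<pi>' s < p1" for p1 s
    using that child H' unfolding tracked_before_def by blast
  have K_of: "q \<in> prios (N j)" "q \<noteq> pr j" if "q \<in> prios (K j)" for q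
    using K_prios(1)[of j] that by auto
  have stack: "\<pi>' s < q" if "s \<in> stack_prios j" "q \<in> prios K'" for s q
    using ob that by (auto simp: obeys_def stack_prios_def)
  show ?thesis unfolding simulates_def
  proof (intro conjI allI impI ballI)
    show "pgoal H'" by fact
    show "denotes (Suc j) (?\<tau> q) (asubst \<delta>' x)" if "(x,q) \<in> H'" for x q by (rule G(3)[OF that])
    show "\<exists>p\<in>prios H'. ?\<tau> p = Current q" if q: "q \<in> prios (N (Suc j))" for q
    proof -
      \<comment> \<open>A surviving priority represents its own class, so a tracker of the atom that
        had priority \<open>q\<close> before merging still tracks \<open>q\<close>.\<close>
      have rq: "red j q = q" using prios_N[OF q] by simp
      consider "q \<in> prios (K j)" | s where "s \<in> ?B" "q = \<pi> j s" using prios_N[OF q] by blast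
      then show ?thesis
      proof cases
        case 1
        then obtain p' where p': "p' \<in> prios H" "\<tau> p' = Current q" using D(3) K_of by blast
        then have "p' \<noteq> p" using cur K_of(2)[OF 1] by force
        then have K': "p' \<in> prios K'" using p'(1) P(1) by simp
        have "?\<tau> p' = Current q" unfolding G(1)[OF K'] using p'(2) K_of(2)[OF 1] rq by simp
        then show ?thesis using K' H'(1) by blast
      next
        case 2
        then show ?thesis using child H'(1) rq by (metis UnI2 imageI)
      qed
    qed
    fix p1 assume p1: "p1 \<in> prios H'"
    show "tracked_before H' ?\<tau> p1 q"
      if q: "q \<in> prios (N (Suc j))" and r: "?\<tau> p1 = Current r" "q < r" for r q
    proof -
      have rq: "red j q = q" using prios_N[OF q] by simp
      have q_cases: "q \<in> prios (K j) \<or> (\<exists>s. s \<in> ?B \<and> q = \<pi> j s)" using prios_N[OF q] by blast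
      show ?thesis
      proof (cases "p1 \<in> prios K'")
        case True
        then have "update j (\<tau> p1) = Current r" using G(1) r by simp
        then obtain x where x: "\<tau> p1 = Current x" "x \<noteq> pr j" "r = red j x"
          by (cases "\<tau> p1") (auto split: if_splits)
        have p1H: "p1 \<in> prios H" using True P(1) by simp
        then obtain y where y: "(y,x) \<in> N j" using D(2) x(1) by (force simp: prios_def)
        then have xK: "(y,x) \<in> K j" using N_cases x(2) by blast
        then have "q < x" using kept r(2) x(3) by force
        from q_cases show ?thesis
        proof (elim disjE exE conjE)
          assume K: "q \<in> prios (K j)"
          then obtain p' where "p' \<in> prios H" "p' < p1" "\<tau> p' = Current q"
            using D(4)[OF p1H x(1) _ \<open>q < x\<close>] K_of by blast
          then show ?thesis using old K_of(2)[OF K] rq by metis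
        next
          fix s assume B: "s \<in> ?B" "q = \<pi> j s"
          have "x \<in> prios (K j)" using xK by (force simp: prios_def)
          \<comment> \<open>A body atom ahead of a kept atom belongs to the stack part, so the
            simulating step also places it before all of \<open>K'\<close>.\<close>
          then have "s \<in> T (c j)" using obeys_iff[OF obeys_N[of j] B(1)] B(2) \<open>q < x\<close> by simp
          then have "\<pi>' s < p1" using stack True B by (simp add: stack_prios_def)
          then show ?thesis using body B rq by metis
        qed
      next
        case False
        then obtain s where s: "s \<in> ?B" "p1 = \<pi>' s" using p1 H' by auto
        then obtain y where y: "(y,s) \<in> snd (c j)" by (force simp: prios_def)
        have "r = red j (\<pi> j s)" using child s r(1) by simp
        then have less: "q < \<pi> j s" using added[OF y] r(2) by simp
        from q_cases show ?thesis
        proof (elim disjE exE conjE)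
          assume K: "q \<in> prios (K j)"
          \<comment> \<open>Conversely, a body atom behind a kept atom belongs to the queue part, so
            the simulating step places it after all of \<open>K'\<close>.\<close>
          then have "s \<notin> T (c j)" using obeys_iff[OF obeys_N[of j] s(1)] less by fastforce
          obtain p' where p': "p' \<in> prios H" "\<tau> p' = Current q" using D(3) K_of(1)[OF K] by blast
          then have "p' \<noteq> p" using cur K_of(2)[OF K] by force
          then have "p' \<in> prios K'" using p'(1) P(1) by simp
          then have "p' < p1" using ob s \<open>s \<notin> T (c j)\<close> by (auto simp: obeys_def)
          then show ?thesis using old[OF p'(1) _ p'(2)] K_of(2)[OF K] rq by metis
        next
          fix s' assume B: "s' \<in> ?B" "q = \<pi> j s'"
          then have "s' < s" using less mono_shift[of j] by (simp add: strict_mono_less)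
          then have "\<pi>' s' < p1" using s mono by (simp add: strict_mono_less)
          then show ?thesis using body B rq by metis
        qed
      qed
    qed
    show "tracked_before H' ?\<tau> p1 q"
      if u: "?\<tau> p1 = Resolved u" "reach (Suc j) u (Current q)" for u q
    proof -
      have p1K: "p1 \<in> prios K'" using p1 H' child u(1) by force
      then have p1H: "p1 \<in> prios H" using P(1) by simp
      have up: "update j (\<tau> p1) = Resolved u" using G(1) u(1) p1K by simp
      have new: "tracked_before H' ?\<tau> p1 q" if "s \<in> stack_prios j" "q = red j (\<pi> j s)" for s
        using body stack p1K that by (simp add: stack_prios_def)
      show ?thesis
      proof (cases "\<tau> p1")
        \<comment> \<open>Here \<open>p1\<close> is a duplicate of the atom being resolved and turns
          into a copy of step \<open>j\<close>. The stack part of that step has just been pushed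
          ahead of \<open>K'\<close>, which establishes the last condition for the
          duplicate.\<close>
        case (Current x)
        then have "u = j" using up by (auto split: if_splits)
        then show ?thesis using reach_last[OF u(2)] new by auto
      next
        case (Resolved v)
        then have ux: "\<tau> p1 = Resolved u" using up by simp
        then have "u < j" using D(2) p1H by (force simp: prios_def)
        from reach_Suc[OF u(2) this] show ?thesis
        proof (elim disjE exE conjE)
          fix y assume y: "reach j u y" "Current q = update j y"
          then obtain x where x: "y = Current x" "x \<noteq> pr j" "q = red j x"
            by (cases y) (auto split: if_splits)
          then show ?thesis using D(5)[OF p1H ux] y(1) old by blast
        next
          assume "\<exists>s\<in>stack_prios j. Current q = Current (red j (\<pi> j s))"
          then show ?thesis using new by auto
        qed
      qed
    qed
  qed
qed

text \<open>Unites copying and advancing, so that the construction of the derivation sees only a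
  clause to apply and instances making it applicable. When advancing, the goal instance is first
  extended by \<omega> of the current step.\<close>

lemma simulation_step:
  assumes sim: "simulates j H \<tau> \<delta>" and sel: "selects H b p K'"
  obtains t \<delta>\<^sub>0 \<mu> where "asubst \<delta>\<^sub>0 b = asubst \<mu> (fst (c t))"
    "\<And>\<pi>' H' \<delta>'. expansion (T (c t)) K' (snd (c t)) \<pi>' \<delta>\<^sub>0 \<mu> H' \<delta>' \<Longrightarrow> \<exists>j' \<tau>'. simulates j' H' \<tau>' \<delta>'"
proof -
  have b: "denotes j (\<tau> p) (asubst \<delta> b)" using simulatesD(2)[OF sim] sel by (simp add: selects_def)
  from selected_tracker[OF sim sel] show ?thesis
  proof (elim disjE exE conjE)
    assume cur: "\<tau> p = Current (pr j)"
    then have "asubst \<delta> b = sel j" using b pgoal_unique[OF pgoal_N[of j]] sel_in_N by auto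
    then have "asubst (subst_comp \<delta> (\<omega> j)) b = asubst (subst_comp (\<xi> j) (inst (Suc j) j)) (fst (c j))"
      using head[of j] by (simp add: asubst_subst_comp[symmetric])
    then show ?thesis using that simulates_current[OF sim sel cur] by blast
  next
    fix t assume t: "t < j" "\<tau> p = Resolved t"
    then have "asubst \<delta> b = asubst (subst_comp (\<xi> t) (inst j t)) (fst (c t))"
      using b head_inst[OF t(1)] by (simp add: asubst_subst_comp)
    then show ?thesis using that simulates_resolved[OF sim sel t(2,1)] by blast
  qed
qed

lemma simulates_nonempty:
  assumes "simulates j H \<tau> \<delta>"
  shows "H \<noteq> {}"
  using simulatesD(3)[OF assms K_prios(2)] by (auto simp: prios_def)

end

section \<open>Construction of the infinite unreduced derivation\<close>

theorem theoremt5p1p1: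
  fixes P :: "('p,'f,'v) clause set" and G :: "('p,'f,'v) pgoal" and SQ :: "('p,'f,'v) pstep set"
  assumes "infinite (UNIV :: 'v set)"
    and "program P"
    and "pgoal G"
    and "stack_queue SQ"
    and "\<forall>d. \<not> inf_sld P SQ G d"
  shows "\<forall>Gs \<alpha> Ns d. \<not> inf_rsld P SQ G Gs \<alpha> Ns d"
proof (intro allI notI)
  fix Gs \<alpha> Ns d assume rsld: "inf_rsld P SQ G Gs \<alpha> Ns d"
  have Gs0: "Gs 0 = G"
    and red: "reduced (Gs j) (\<alpha> j) (Ns j) (gvars (iter_subst (\<lambda>i. st_mgu (d i)) j G))"
    and d: "is_step (d j)" "st_src (d j) = Ns j" "st_res (d j) = Gs (Suc j)" "st_cl (d j) \<in> P" "d j \<in> SQ" for j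
    using rsld unfolding inf_rsld_def by blast+
  have SQ: "complete_steps SQ" using assms(4) by (simp add: stack_queue_def)
  obtain T :: "('p,'f,'v) clause \<Rightarrow> rat set" where
    T: "\<And>s a p K. s \<in> SQ \<Longrightarrow> selects (st_src s) a p K \<Longrightarrow>
       obeys (T (st_cl s)) (prios K) (st_shift s) (prios (snd (st_cl s)))"
    using stack_queue_obeys[OF assms(4)] by blast
  have pgoal_Gs: "pgoal (Gs j)" for j
    using Gs0 assms(3) pgoal_st_res[OF d(1)] d(3) by (cases j) metis+
  have "\<exists>f. (\<forall>x p. (x,p) \<in> Gs j \<longrightarrow> f p \<le> p \<and> (asubst (\<alpha> j) x, f p) \<in> Ns j) \<and>
      (\<forall>q. q \<in> prios (Ns j) \<longrightarrow> q \<in> prios (Gs j) \<and> f q = q)" for j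
    using reduced_map[OF red pgoal_Gs, of j] by metis
  then obtain f where
    f1: "\<And>j x p. (x,p) \<in> Gs j \<Longrightarrow> f j p \<le> p \<and> (asubst (\<alpha> j) x, f j p) \<in> Ns j" and
    f2: "\<And>j q. q \<in> prios (Ns j) \<Longrightarrow> q \<in> prios (Gs j) \<and> f j q = q"
    by metis
  have "\<exists>a p K. selects (Ns j) a p K" for j
    using is_step_selects[OF d(1)[of j]] d(2)[of j] by metis
  then obtain sel pr K where sel: "\<And>j. selects (Ns j) (sel j) (pr j) (K j)" by metis
  have D: "is_clause (st_cl (d j))" "pgoal (Ns j)" "shifting (st_shift (d j))"
    "asubst (st_mgu (d j)) (sel j) = asubst (st_mgu (d j)) (asubst (st_ren (d j)) (fst (st_cl (d j))))"
    "Gs (Suc j) = gsubst (st_mgu (d j))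
       (K j \<union> gshift (st_shift (d j)) (gsubst (st_ren (d j)) (snd (st_cl (d j)))))" for j
    using is_stepD[OF d(1)[of j], of "sel j" "pr j" "K j"] sel[of j] d(2,3)[of j] by simp_all
  interpret reduced_trace Ns sel pr K "\<lambda>j. st_cl (d j)" "\<lambda>j. st_ren (d j)" "\<lambda>j. st_shift (d j)"
    "\<lambda>j. subst_comp (st_mgu (d j)) (\<alpha> (Suc j))" "\<lambda>j. f (Suc j)" T
  proof (unfold_locales, goal_cases)
    case (1 j)
    then show ?case by (rule D(2))
  next
    case (2 j)
    then show ?case by (rule sel)
  next
    case (3 j)
    then show ?case using T[OF d(5), of j] sel[of j] d(2)[of j] by simp
  next
    case (4 j)
    then show ?case using D(3)[of j] by (simp add: shifting_def)
  next
    case (5 j)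
    then show ?case using D(4)[of j] by (simp add: asubst_subst_comp[symmetric])
  next
    case (6 y q j)
    then have "(asubst (st_mgu (d j)) y, q) \<in> Gs (Suc j)" by (force simp: D(5) gsubst_def)
    from f1[OF this] show ?case by (simp add: asubst_subst_comp[symmetric])
  next
    case (7 y s j)
    then have "(asubst (st_mgu (d j)) (asubst (st_ren (d j)) y), st_shift (d j) s) \<in> Gs (Suc j)"
      by (force simp: D(5) gsubst_def gshift_def)
    from f1[OF this] show ?case by (simp add: asubst_subst_comp[symmetric])
  next
    case (8 q j)
    from f2[OF this] show ?case by (simp add: D(5) prios_simps)
  qed
  \<comment> \<open>\<open>V\<close> collects the variables of \<open>G\<close> and of all clauses
    renamed so far. It stays finite, so fresh variables always remain.\<close>
  define good where "good H V \<longleftrightarrow> finite V \<and> (\<exists>j \<tau> \<delta>. simulates j H \<tau> \<delta>)" for H and V :: "'v set"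
  define ok where "ok s V \<longleftrightarrow> s \<in> SQ \<and> is_step s \<and> st_cl s \<in> P \<and> renamed_vars s \<inter> V = {} \<and>
     good (st_res s) (V \<union> renamed_vars s)" for s V
  have next_step: "\<exists>s. st_src s = H \<and> ok s V" if H: "good H V" for H V
  proof -
    obtain j \<tau> \<delta> where sim: "simulates j H \<tau> \<delta>" and V: "finite V" using H unfolding good_def by blast
    note pgoal_H = simulatesD(1)[OF sim]
    obtain b p K' where sel': "selects H b p K'"
      using selects_exists[OF pgoal_H simulates_nonempty[OF sim]] .
    obtain t \<delta>\<^sub>0 \<mu> where unif: "asubst \<delta>\<^sub>0 b = asubst \<mu> (fst (st_cl (d t)))" and
      ex: "\<And>\<pi>' H' \<delta>'. expansion (T (st_cl (d t))) K' (snd (st_cl (d t))) \<pi>' \<delta>\<^sub>0 \<mu> H' \<delta>' \<Longrightarrow>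
         \<exists>j' \<tau>'. simulates j' H' \<tau>' \<delta>'"
      by (rule simulation_step[OF sim sel']) (rule that)
    obtain s \<delta>' where s: "s \<in> SQ" "st_src s = H" "st_cl s = st_cl (d t)" "renamed_vars s \<inter> V = {}"
      "expansion (T (st_cl (d t))) K' (snd (st_cl (d t))) (st_shift s) \<delta>\<^sub>0 \<mu> (st_res s) \<delta>'"
      by (rule lifting_step[OF assms(1) SQ T D(1) pgoal_H sel' unif V]) (assumption, assumption, rule that)
    have "finite (renamed_vars s)"
      using pgoal_gsubst[of "snd (st_cl s)" "st_ren s"] D(1)[of t] s(3)
      by (simp add: renamed_vars_def cvars_def csubst_def finite_avars finite_gvars is_clause_def pgoal_def)
    then have "good (st_res s) (V \<union> renamed_vars s)" using V ex[OF s(5)] by (auto simp: good_def)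
    moreover have "is_step s" using SQ s(1) by (simp add: complete_steps_def)
    ultimately have "ok s V" using s d(4)[of t] by (simp add: ok_def)
    then show ?thesis using s(2) by blast
  qed
  \<comment> \<open>A reduction precedes the first step, so an atom of \<open>G\<close> tracks its
    representative rather than its own priority.\<close>
  have "simulates 0 G (\<lambda>p. Current (f 0 p)) (\<alpha> 0)"
    unfolding simulates_def
  proof (intro conjI allI impI ballI)
    show "pgoal G" by fact
    show "denotes 0 (Current (f 0 p)) (asubst (\<alpha> 0) x)" if "(x,p) \<in> G" for x p
      using f1[of x p 0] that Gs0 by simp
    show "\<exists>p\<in>prios G. Current (f 0 p) = Current q" if "q \<in> prios (Ns 0)" for q
      using f2[OF that] Gs0 by auto
    show "tracked_before G (\<lambda>p. Current (f 0 p)) p q"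
      if p: "p \<in> prios G" "Current (f 0 p) = Current r" and q: "q \<in> prios (Ns 0)" "q < r" for p q r
    proof -
      \<comment> \<open>Hence \<open>q < f 0 p \<le> p\<close>, and position \<open>q\<close>, which
        tracks itself, is the required earlier one.\<close>
      have "f 0 p \<le> p" using p(1) f1[of _ p 0] Gs0 by (auto simp: prios_def)
      then show ?thesis using f2[OF q(1)] Gs0 p(2) q(2)
        unfolding tracked_before_def by (intro bexI[of _ q]) auto
    qed
    show "tracked_before G (\<lambda>p. Current (f 0 p)) p q" if "Current (f 0 p) = Resolved t" for p q t
      using that by simp
  qed
  then have start: "good G (gvars G)"
    using finite_gvars assms(3) unfolding good_def pgoal_def by blast
  \<comment> \<open>Dependent choice runs over steps paired with the used variables; the condition
    at \<open>n = 0\<close> fixes the start.\<close>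
  define chain where "chain n sV \<longleftrightarrow> (n = 0 \<longrightarrow> st_src (fst sV) = G \<and> snd sV = gvars G) \<and>
    ok (fst sV) (snd sV)" for n :: nat and sV
  define link where "link sV sV' \<longleftrightarrow> st_src (fst sV') = st_res (fst sV) \<and>
    snd sV' = snd sV \<union> renamed_vars (fst sV)" for sV sV' :: "('p,'f,'v) pstep \<times> 'v set"
  have "\<exists>D. \<forall>n. chain n (D n) \<and> link (D n) (D (Suc n))"
  proof (rule dependent_nat_choice)
    show "\<exists>x. chain 0 x" using next_step[OF start] by (auto simp: chain_def)
    show "\<exists>y. chain (Suc n) y \<and> link x y" if "chain n x" for x n
      using that next_step[of "st_res (fst x)" "snd x \<union> renamed_vars (fst x)"]
      by (auto simp: chain_def link_def ok_def)
  qed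
  then obtain D where D: "\<And>n. chain n (D n)" "\<And>n. link (D n) (D (Suc n))" by blast
  have vars: "snd (D n) = gvars G \<union> (\<Union>i<n. renamed_vars (fst (D i)))" for n
    using D by (induction n) (auto simp: chain_def link_def lessThan_Suc)
  have "inf_sld P SQ G (\<lambda>n. fst (D n))"
    unfolding inf_sld_def
    using D vars by (auto simp: chain_def link_def ok_def)
  then show False using assms(5) by blast
qed

end
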